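(* The inclusion of groups $i\colon\mathrm{SU}(2)\to\mathrm U(2)^{\pm1}$ sets up, via $i^{-1}(\mathsf G)=\mathsf G\cap\mathrm{SU}(2)$, a bijection between the conjugacy classes of finite complex reflection groups $\mathsf G\leqslant\mathrm U(2)^{\pm1}\leqslant\mathrm{GL}(2,\mathbb C)$ and the conjugacy classes of finite subgroups of $\mathrm{SU}(2)$.
   Context: $\mathrm U(2)^{\pm1}=\{A\in\mathrm{GL}(2,\mathbb C)\mid A\overline A^{T}=\mathbf 1,\ \det A=\pm1\}$ is the unimodular unitary group, and $\mathrm{SU}(2)$ is its subgroup of matrices of determinant $1$. A reflection in $\mathrm{GL}(2,\mathbb C)$ is a linear map of the form $v\mapsto v-2\lambda(v)a$ with $\lambda$ a linear form on $\mathbb C^2$ and $a\in\mathbb C^2$ a vector with $\lambda(a)=1$; equivalently, a $2\times2$ matrix with trace $0$ and determinant $-1$. A finite complex reflection group here is a finite subgroup generated by such reflections.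
   Formalization: The trivial group is not counted as a reflection group (the generating set of reflections must be nonempty); otherwise the trivial group and a group of order two generated by a reflection would both meet SU(2) trivially and the map would not be injective. *)

theory Defs
  imports "HOL-Analysis.Analysis" "HOL-Algebra.Algebra"
begin

definition GL2 :: "(complex^2^2) monoid" where
  "GL2 = \<lparr>carrier = {A. invertible A}, mult = (**), one = mat 1\<rparr>"

definition conj_transpose :: "complex^'n^'m \<Rightarrow> complex^'m^'n" where
  "conj_transpose A = (\<chi> i j. cnj (A $ j $ i))"

definition U2pm :: "(complex^2^2) monoid" where
  "U2pm = GL2\<lparr>carrier := {A. A ** conj_transpose A = mat 1 \<and> (det A = 1 \<or> det A = - 1)}\<rparr>"

definition SU2 :: "(complex^2^2) monoid" where
  "SU2 = U2pm\<lparr>carrier := {A \<in> carrier U2pm. det A = 1}\<rparr>"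

definition is_reflection :: "complex^2^2 \<Rightarrow> bool" where
  "is_reflection A \<longleftrightarrow>
     (\<exists>lam a. Vector_Spaces.linear (*s) (*) lam \<and> lam a = 1 \<and>
        (\<forall>v. A *v v = v - (2 * lam v) *s a))"

text \<open>The generating set is required to be nonempty, so the trivial group is not a
  reflection group. Otherwise the trivial group and every group of order two generated by a
  reflection would have the same (trivial) intersection with \<open>SU2\<close>.\<close>

definition finite_reflection_group :: "(complex^2^2) set \<Rightarrow> bool" where
  "finite_reflection_group G \<longleftrightarrow> subgroup G GL2 \<and> finite G \<and>
     (\<exists>S. S \<noteq> {} \<and> (\<forall>A\<in>S. is_reflection A) \<and> G = generate GL2 S)"

definition conj_class :: "('a, 'b) monoid_scheme \<Rightarrow> 'a set \<Rightarrow> 'a set set" where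
  "conj_class K H = {(g <#\<^bsub>K\<^esub> H) #>\<^bsub>K\<^esub> (inv\<^bsub>K\<^esub> g) | g. g \<in> carrier K}"

lemma group_GL2: "group GL2"
proof (rule groupI)
  fix A assume "A \<in> carrier GL2"
  then obtain B where "A ** B = mat 1" "B ** A = mat 1"
    by (auto simp: GL2_def invertible_def)
  then show "\<exists>B\<in>carrier GL2. B \<otimes>\<^bsub>GL2\<^esub> A = \<one>\<^bsub>GL2\<^esub>"
    by (auto simp: GL2_def invertible_def)
qed (auto simp: GL2_def invertible_mult matrix_mul_assoc invertible_def[of "mat 1"])

lemma conj_transpose_mult: "conj_transpose (A ** B) = conj_transpose B ** conj_transpose A"
  by (simp add: conj_transpose_def matrix_matrix_mult_def vec_eq_iff mult.commute)

lemma conj_transpose_mat1: "conj_transpose (mat 1) = mat 1"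
  by (simp add: conj_transpose_def mat_def vec_eq_iff)

lemma conj_transpose_conj_transpose: "conj_transpose (conj_transpose A) = A"
  by (simp add: conj_transpose_def vec_eq_iff)

lemma subgroup_U2pm_GL2: "subgroup (carrier U2pm) GL2"
proof (rule group.subgroupI[OF group_GL2])
  show "carrier U2pm \<subseteq> carrier GL2"
    by (auto simp: U2pm_def GL2_def invertible_right_inverse)
  have "mat 1 \<in> carrier U2pm" by (simp add: U2pm_def conj_transpose_mat1)
  then show "carrier U2pm \<noteq> {}" by auto
next
  fix A assume A: "A \<in> carrier U2pm"
  then have 1: "A ** conj_transpose A = mat 1" and d: "det A = 1 \<or> det A = -1"
    by (auto simp: U2pm_def)
  then have 2: "conj_transpose A ** A = mat 1" by (simp add: matrix_left_right_inverse)
  have "inv\<^bsub>GL2\<^esub> A = conj_transpose A"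
    by (rule group.inv_equality[OF group_GL2])
       (use 1 2 in \<open>auto simp: GL2_def invertible_def\<close>)
  moreover have "det (conj_transpose A) * det A = 1"
    using 2 by (metis det_I det_mul)
  ultimately show "inv\<^bsub>GL2\<^esub> A \<in> carrier U2pm"
    using 2 d by (auto simp: U2pm_def conj_transpose_conj_transpose minus_equation_iff)
next
  fix A B assume A: "A \<in> carrier U2pm" and B: "B \<in> carrier U2pm"
  have "A ** B ** (conj_transpose B ** conj_transpose A)
      = A ** (B ** conj_transpose B) ** conj_transpose A"
    by (simp add: matrix_mul_assoc)
  also have "\<dots> = mat 1" using A B by (simp add: U2pm_def)
  finally show "A \<otimes>\<^bsub>GL2\<^esub> B \<in> carrier U2pm"
    using A B by (auto simp: U2pm_def GL2_def conj_transpose_mult det_mul)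
qed

lemma group_U2pm: "group U2pm"
  using group.subgroup_imp_group[OF group_GL2 subgroup_U2pm_GL2] by (simp add: U2pm_def)

lemma subgroup_SU2_U2pm: "subgroup (carrier SU2) U2pm"
proof (rule group.subgroupI[OF group_U2pm])
  show "carrier SU2 \<subseteq> carrier U2pm" by (auto simp: SU2_def)
  have "mat 1 \<in> carrier SU2" by (simp add: SU2_def U2pm_def conj_transpose_mat1)
  then show "carrier SU2 \<noteq> {}" by auto
next
  fix A assume A: "A \<in> carrier SU2"
  then have AU: "A \<in> carrier U2pm" by (simp add: SU2_def)
  have "inv\<^bsub>U2pm\<^esub> A \<otimes>\<^bsub>U2pm\<^esub> A = \<one>\<^bsub>U2pm\<^esub>"
    by (rule group.l_inv[OF group_U2pm AU])
  then have "det (inv\<^bsub>U2pm\<^esub> A) * det A = 1"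
    by (simp add: U2pm_def GL2_def flip: det_mul)
  then show "inv\<^bsub>U2pm\<^esub> A \<in> carrier SU2"
    using A group.inv_closed[OF group_U2pm AU] by (simp add: SU2_def)
next
  fix A B assume A: "A \<in> carrier SU2" and B: "B \<in> carrier SU2"
  then have "A \<otimes>\<^bsub>U2pm\<^esub> B \<in> carrier U2pm"
    by (intro monoid.m_closed group.is_monoid group_U2pm) (auto simp: SU2_def)
  moreover have "det (A \<otimes>\<^bsub>U2pm\<^esub> B) = 1"
    using A B by (simp add: SU2_def U2pm_def GL2_def det_mul)
  ultimately show "A \<otimes>\<^bsub>U2pm\<^esub> B \<in> carrier SU2" by (simp add: SU2_def)
qed

lemma group_SU2: "group SU2"
  using group.subgroup_imp_group[OF group_U2pm subgroup_SU2_U2pm] by (simp add: SU2_def)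

end

theory Submission
  imports Defs
begin

text \<open>
  Identify \<open>SU2\<close> with the unit quaternions; then the elements of determinant \<open>-1\<close> are the \<open>i q\<close>
  with \<open>q\<close> a unit quaternion, and \<open>i q\<close> is a reflection iff \<open>q * q = -1\<close>. A reflection group has the
  form \<open>G = H \<union> i Q\<close> with \<open>H = G \<inter> SU2\<close> and \<open>Q\<close> a coset of \<open>H\<close>.

  Counting the fixed axes of the rotations in \<open>H\<close> shows that a nonabelian \<open>H\<close> has exactly three orbits
  of axes, of one of the types \<open>(2,2,n)\<close>, \<open>(2,3,3)\<close>, \<open>(2,3,4)\<close>, \<open>(2,3,5)\<close>.

  Existence of \<open>G\<close>: comparing types, \<open>H\<close> is generated by the stabilizers of two axes \<open>x\<close> and \<open>y\<close>. A unit
  imaginary quaternion \<open>q\<close> orthogonal to both inverts these generators \<open>s\<close>, and \<open>H\<close> together with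
  the reflections \<open>i q\<close> and \<open>i q s\<close> generates a reflection group meeting \<open>SU2\<close> exactly in \<open>H\<close>.

  Uniqueness of \<open>G\<close>: if \<open>H\<close> is abelian, the choices of \<open>Q\<close> are conjugate by rotations about its axis.
  In the dihedral case \<open>Q\<close> contains an axis of \<open>H\<close>. Otherwise the type of the group \<open>H \<union> Q\<close>, whose order
  is \<open>card H\<close> or \<open>2 * card H\<close>, forces \<open>Q = H\<close>, or the pair is tetrahedral in octahedral and \<open>Q\<close> contains
  a square root of an axis of \<open>H\<close> of order two.
\<close>

section \<open>Quaternions\<close>

datatype quat = Quat (qre: real) (qi: real) (qj: real) (qk: real)

lemma quat_eq_iff: "p = q \<longleftrightarrow> qre p = qre q \<and> qi p = qi q \<and> qj p = qj q \<and> qk p = qk q"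
  by (cases p; cases q) simp

instantiation quat :: division_ring
begin

definition "0 = Quat 0 0 0 0"
definition "1 = Quat 1 0 0 0"
definition "p + q = Quat (qre p + qre q) (qi p + qi q) (qj p + qj q) (qk p + qk q)"
definition "p - q = Quat (qre p - qre q) (qi p - qi q) (qj p - qj q) (qk p - qk q)"
definition "- q = Quat (- qre q) (- qi q) (- qj q) (- qk q)"
definition "p * q = Quat
  (qre p * qre q - qi p * qi q - qj p * qj q - qk p * qk q)
  (qre p * qi q + qi p * qre q + qj p * qk q - qk p * qj q)
  (qre p * qj q - qi p * qk q + qj p * qre q + qk p * qi q)
  (qre p * qk q + qi p * qj q - qj p * qi q + qk p * qre q)"
text \<open>For \<open>q = 0\<close> the real inverse \<open>m\<close> is \<open>0\<close>, which
  gives the value \<open>inverse 0 = 0\<close> that \<open>division_ring\<close> demands.\<close>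

definition "inverse q =
  (let m = inverse (qre q * qre q + qi q * qi q + qj q * qj q + qk q * qk q) in
  Quat (qre q * m) (- qi q * m) (- qj q * m) (- qk q * m))" for q :: quat
definition "divide p q = p * inverse q" for p q :: quat

lemma quat_sel [simp]:
  "qre 0 = 0" "qi 0 = 0" "qj 0 = 0" "qk 0 = 0"
  "qre 1 = 1" "qi 1 = 0" "qj 1 = 0" "qk 1 = 0"
  "qre (p + q) = qre p + qre q" "qi (p + q) = qi p + qi q"
  "qj (p + q) = qj p + qj q" "qk (p + q) = qk p + qk q"
  "qre (p - q) = qre p - qre q" "qi (p - q) = qi p - qi q"
  "qj (p - q) = qj p - qj q" "qk (p - q) = qk p - qk q"
  "qre (- q) = - qre q" "qi (- q) = - qi q" "qj (- q) = - qj q" "qk (- q) = - qk q"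
  "qre (p * q) = qre p * qre q - qi p * qi q - qj p * qj q - qk p * qk q"
  "qi (p * q) = qre p * qi q + qi p * qre q + qj p * qk q - qk p * qj q"
  "qj (p * q) = qre p * qj q - qi p * qk q + qj p * qre q + qk p * qi q"
  "qk (p * q) = qre p * qk q + qi p * qj q - qj p * qi q + qk p * qre q"
  by (simp_all add: zero_quat_def one_quat_def plus_quat_def minus_quat_def uminus_quat_def
      times_quat_def)

lemma sum4_squares_pos:
  fixes a b c d :: real
  assumes "a \<noteq> 0 \<or> b \<noteq> 0 \<or> c \<noteq> 0 \<or> d \<noteq> 0"
  shows "a * a + b * b + c * c + d * d \<noteq> 0"
proof
  assume "a * a + b * b + c * c + d * d = 0"
  moreover have "a * a \<ge> 0" "b * b \<ge> 0" "c * c \<ge> 0" "d * d \<ge> 0" by auto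
  ultimately have "a * a = 0" "b * b = 0" "c * c = 0" "d * d = 0" by linarith+
  with assms show False by simp
qed

instance
proof
  fix q :: quat assume "q \<noteq> 0"
  then have n: "qre q * qre q + qi q * qi q + qj q * qj q + qk q * qk q \<noteq> 0"
    by (intro sum4_squares_pos) (auto simp: quat_eq_iff)
  define m where "m = inverse (qre q * qre q + qi q * qi q + qj q * qj q + qk q * qk q)"
  have m: "(qre q * qre q + qi q * qi q + qj q * qj q + qk q * qk q) * m = 1"
    using n by (simp add: m_def)
  have "inverse q = Quat (qre q * m) (- qi q * m) (- qj q * m) (- qk q * m)"
    by (simp add: inverse_quat_def Let_def m_def)
  then show "inverse q * q = 1" "q * inverse q = 1"
    using m by (simp_all add: quat_eq_iff algebra_simps)
qed (simp_all add: quat_eq_iff algebra_simps divide_quat_def inverse_quat_def Let_def)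

end

definition qnorm :: "quat \<Rightarrow> real" where
  "qnorm q = qre q * qre q + qi q * qi q + qj q * qj q + qk q * qk q"

lemma qnorm_mult: "qnorm (p * q) = qnorm p * qnorm q"
  by (simp add: qnorm_def algebra_simps)

lemma qnorm_1 [simp]: "qnorm 1 = 1" and qnorm_uminus [simp]: "qnorm (- q) = qnorm q"
  by (simp_all add: qnorm_def)

lemma qnorm_1_nonzero: "qnorm q = 1 \<Longrightarrow> q \<noteq> 0"
  by (auto simp: qnorm_def)

lemma qnorm_inverse: "qnorm q = 1 \<Longrightarrow> qnorm (inverse q) = 1"
  by (metis mult_1 qnorm_1 qnorm_1_nonzero qnorm_mult right_inverse)

definition qcnj :: "quat \<Rightarrow> quat" where
  "qcnj q = Quat (qre q) (- qi q) (- qj q) (- qk q)"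

lemma inverse_unit: "qnorm q = 1 \<Longrightarrow> inverse q = qcnj q"
  by (simp add: inverse_quat_def qcnj_def qnorm_def)

section \<open>Square roots of -1\<close>

definition imag_units :: "quat set" where
  "imag_units = {u. u * u = - 1}"

text \<open>The imaginary part of \<open>u * u\<close> is \<open>2 * qre u\<close> times that of
  \<open>u\<close>; if \<open>qre u\<close> were nonzero, \<open>u\<close> would be real with a
  negative square. So these elements form the unit sphere of imaginary space: they serve as oriented
  rotation axes and, multiplied by \<open>\<i>\<close>, as reflections.\<close>

lemma imag_units_iff: "u \<in> imag_units \<longleftrightarrow> qre u = 0 \<and> qnorm u = 1"
proof
  assume "u \<in> imag_units"
  then have e: "u * u = -1" by (simp add: imag_units_def)
  have "qre u = 0"
  proof (rule ccontr)
    assume "qre u \<noteq> 0"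
    with e have "qi u = 0" "qj u = 0" "qk u = 0" by (auto simp: quat_eq_iff)
    with e have "qre u * qre u = -1" by (simp add: quat_eq_iff)
    then show False by (smt (verit) zero_le_square)
  qed
  with e show "qre u = 0 \<and> qnorm u = 1" by (simp add: quat_eq_iff qnorm_def)
next
  assume "qre u = 0 \<and> qnorm u = 1"
  then show "u \<in> imag_units"
    by (auto simp: imag_units_def quat_eq_iff qnorm_def)
qed

lemma imag_units_norm: "u \<in> imag_units \<Longrightarrow> qnorm u = 1"
  by (simp add: imag_units_iff)

lemma imag_units_uminus [simp]: "- u \<in> imag_units \<longleftrightarrow> u \<in> imag_units"
  by (simp add: imag_units_def)

lemma imag_units_sq: "u \<in> imag_units \<Longrightarrow> u * u = - 1"
  by (simp add: imag_units_def)

lemma imag_units_nonzero: "u \<in> imag_units \<Longrightarrow> u \<noteq> 0"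
  by (auto simp: imag_units_def)

lemma imag_units_inverse: "u \<in> imag_units \<Longrightarrow> inverse u = - u"
  by (metis imag_units_sq inverse_unique minus_mult_right minus_minus)

lemma quat_uminus_neq: "q \<noteq> 0 \<Longrightarrow> - q \<noteq> (q::quat)"
  by (auto simp: quat_eq_iff)

text \<open>Here \<open>(u * v) * (u * v) = 1\<close>, and in a division ring only \<open>1\<close>
  and \<open>- 1\<close> have square 1.\<close>

lemma imag_units_commute_eq:
  assumes "u \<in> imag_units" "v \<in> imag_units" "u * v = v * u"
  shows "v = u \<or> v = - u"
proof -
  have "(u * v) * (u * v) = u * u * (v * v)"
    using assms(3) by (metis mult.assoc)
  then have "(u * v) * (u * v) = 1" using assms by (simp add: imag_units_sq)
  then have "u * v = 1 \<or> u * v = - 1" by (simp add: square_eq_1_iff)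
  then show ?thesis
    by (metis assms(1) imag_units_inverse inverse_unique minus_minus minus_mult_right)
qed

section \<open>Centralizers and orthogonality\<close>

definition qscale :: "real \<Rightarrow> quat \<Rightarrow> quat" where
  "qscale t q = Quat (t * qre q) (t * qi q) (t * qj q) (t * qk q)"

lemma qscale_sel [simp]:
  "qre (qscale t q) = t * qre q" "qi (qscale t q) = t * qi q"
  "qj (qscale t q) = t * qj q" "qk (qscale t q) = t * qk q"
  by (simp_all add: qscale_def)

lemma qscale_mult: "qscale t p * q = qscale t (p * q)" "p * qscale t q = qscale t (p * q)"
  by (simp_all add: quat_eq_iff algebra_simps)

lemma qscale_uminus: "qscale t (- p) = - qscale t p"
  by (simp add: quat_eq_iff)

lemma qnorm_qscale: "qnorm (qscale t q) = t\<^sup>2 * qnorm q"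
  by (simp add: qnorm_def algebra_simps power2_eq_square)

lemma normalize_exists:
  assumes "q \<noteq> 0"
  obtains t where "qnorm (qscale t q) = 1"
proof -
  have n: "qnorm q > 0"
  proof -
    have "qnorm q \<noteq> 0"
      unfolding qnorm_def using assms by (intro sum4_squares_pos) (auto simp: quat_eq_iff)
    moreover have "qnorm q \<ge> 0" by (simp add: qnorm_def)
    ultimately show ?thesis by simp
  qed
  have "qnorm (qscale (1 / sqrt (qnorm q)) q) = 1"
    using n by (simp add: qnorm_qscale power_divide)
  then show thesis by (rule that)
qed

text \<open>The commutation relation says that the imaginary part of \<open>h\<close> has zero cross
  product with \<open>u\<close>. It therefore equals its projection onto \<open>u\<close>, whose
  coefficient is the inner product \<open>t\<close>.\<close>

lemma commute_imag_decomp: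
  assumes u: "u \<in> imag_units" and h: "h * u = u * h"
  obtains s t where "h = qscale s 1 + qscale t u"
proof -
  have n: "qi u * qi u + qj u * qj u + qk u * qk u = 1" and r: "qre u = 0"
    using u by (auto simp: imag_units_iff qnorm_def)
  have e: "qj h * qk u = qk h * qj u" "qk h * qi u = qi h * qk u" "qi h * qj u = qj h * qi u"
    using h by (auto simp: quat_eq_iff algebra_simps)
  define t where "t = qi h * qi u + qj h * qj u + qk h * qk u"
  have "qi h = qi h * qi u * qi u + qi h * qj u * qj u + qi h * qk u * qk u"
    using n by (simp add: mult.assoc flip: distrib_left)
  then have 1: "qi h = t * qi u" unfolding e(3) e(2)[symmetric] t_def by (simp add: algebra_simps)
  have "qj h = qj h * qi u * qi u + qj h * qj u * qj u + qj h * qk u * qk u"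
    using n by (simp add: mult.assoc flip: distrib_left)
  then have 2: "qj h = t * qj u" unfolding e(1) e(3)[symmetric] t_def by (simp add: algebra_simps)
  have "qk h = qk h * qi u * qi u + qk h * qj u * qj u + qk h * qk u * qk u"
    using n by (simp add: mult.assoc flip: distrib_left)
  then have 3: "qk h = t * qk u" unfolding e(2) e(1)[symmetric] t_def by (simp add: algebra_simps)
  show thesis
    by (rule that[of "qre h" t]) (use 1 2 3 r in \<open>auto simp: quat_eq_iff\<close>)
qed

text \<open>The centralizer of \<open>u\<close> is the plane spanned by \<open>1\<close> and
  \<open>u\<close>, a copy of the complex numbers.\<close>

lemma commute_imag_trans:
  assumes "u \<in> imag_units" "h * u = u * h" "k * u = u * k"
  shows "h * k = k * h"
proof -
  obtain s t where "h = qscale s 1 + qscale t u" using commute_imag_decomp assms by metis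
  then show ?thesis using assms(3) by (simp add: distrib_left distrib_right qscale_mult)
qed

text \<open>A nontrivial rotation has a single axis: writing \<open>h\<close> as
  \<open>s + t u\<close>, the coefficient \<open>t\<close> is nonzero, so commuting with
  \<open>h\<close> amounts to commuting with \<open>u\<close>.\<close>

lemma axis_commute:
  assumes h: "qnorm h = 1" "h \<noteq> 1" "h \<noteq> - 1"
    and u: "u \<in> imag_units" "h * u = u * h" and v: "h * v = v * h"
  shows "v * u = u * v"
proof -
  obtain s t where d: "h = qscale s 1 + qscale t u" using commute_imag_decomp[OF u] .
  have "t \<noteq> 0"
  proof
    assume "t = 0"
    then have hs: "h = qscale s 1" using d by (simp add: quat_eq_iff)
    then have "s * s = 1" using h(1) by (simp add: qnorm_def)
    then have "s = 1 \<or> s = -1" by (simp add: square_eq_1_iff)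
    then show False using hs h by (auto simp: quat_eq_iff)
  qed
  moreover have "qscale t (v * u) = qscale t (u * v)"
    using v by (simp add: d distrib_left distrib_right qscale_mult)
  ultimately show ?thesis by (simp add: quat_eq_iff mult.commute)
qed

text \<open>For imaginary quaternions anticommuting means orthogonality. Right multiplication by
  \<open>h\<close>, a unit in the span of \<open>1\<close> and \<open>x\<close>, rotates
  \<open>q\<close> inside the plane orthogonal to \<open>x\<close>.\<close>

lemma anticommute_imag_mult:
  assumes "x \<in> imag_units" "q \<in> imag_units" "q * x = - (x * q)" "h * x = x * h" "qnorm h = 1"
  shows "q * h \<in> imag_units"
proof -
  obtain s t where h: "h = qscale s 1 + qscale t x" using commute_imag_decomp assms by metis
  have "qre (q * x) = 0" using assms(3) by (auto simp: quat_eq_iff algebra_simps)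
  \<comment> \<open>The rule for \<open>qre (p * q)\<close> is switched off so that
    \<open>qre (q * x) = 0\<close> applies before it gets expanded.\<close>
  then have "qre (q * h) = 0"
    using assms(2) by (simp add: h distrib_left qscale_mult imag_units_iff del: quat_sel(21))
  moreover have "qnorm (q * h) = 1" using assms by (simp add: qnorm_mult imag_units_norm)
  ultimately show ?thesis by (simp add: imag_units_iff)
qed

lemma axis_exists:
  assumes "qnorm h = 1" "h \<noteq> 1" "h \<noteq> - 1"
  obtains u where "u \<in> imag_units" "h * u = u * h"
proof -
  define v where "v = Quat 0 (qi h) (qj h) (qk h)"
  have "v \<noteq> 0"
  proof
    assume "v = 0"
    then have z: "qi h = 0" "qj h = 0" "qk h = 0" by (auto simp: v_def quat_eq_iff)
    then have "qre h * qre h = 1" using assms by (simp add: qnorm_def)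
    then have "qre h = 1 \<or> qre h = -1" by (simp add: square_eq_1_iff)
    with z assms show False by (auto simp: quat_eq_iff)
  qed
  then obtain t where "qnorm (qscale t v) = 1" by (rule normalize_exists)
  then have "qscale t v \<in> imag_units" by (simp add: imag_units_iff v_def)
  moreover have "h * qscale t v = qscale t v * h"
    by (simp add: v_def quat_eq_iff algebra_simps)
  ultimately show thesis by (rule that)
qed

lemma orthogonal_imag_exists:
  assumes "x \<in> imag_units"
  obtains q where "q \<in> imag_units" "q * x = - (x * q)"
proof -
  have "\<exists>q. q \<noteq> 0 \<and> qre q = 0 \<and> qi q * qi x + qj q * qj x + qk q * qk x = 0"
  proof (cases "qi x = 0")
    case True
    then show ?thesis by (intro exI[of _ "Quat 0 1 0 0"]) (auto simp: quat_eq_iff)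
  next
    case False
    then show ?thesis by (intro exI[of _ "Quat 0 (- qj x) (qi x) 0"]) (auto simp: quat_eq_iff)
  qed
  then obtain q where q: "q \<noteq> 0" "qre q = 0" "qi q * qi x + qj q * qj x + qk q * qk x = 0" by auto
  obtain t where t: "qnorm (qscale t q) = 1" using normalize_exists[OF q(1)] .
  have "q * x = - (x * q)"
    using assms q by (simp add: quat_eq_iff imag_units_iff algebra_simps)
  then have "qscale t q * x = - (x * qscale t q)"
    by (simp add: qscale_mult qscale_uminus)
  with t q show thesis by (intro that[of "qscale t q"]) (auto simp: imag_units_iff)
qed

lemma orthogonal_imag_exists2:
  assumes "x \<in> imag_units" "y \<in> imag_units"
  obtains q where "q \<in> imag_units" "q * x = - (x * q)" "q * y = - (y * q)"
proof (cases "x * y = y * x")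
  case True
  then have y: "y = x \<or> y = - x" using assms imag_units_commute_eq by blast
  obtain q where q: "q \<in> imag_units" "q * x = - (x * q)"
    using orthogonal_imag_exists[OF assms(1)] .
  with y have "q * y = - (y * q)" by fastforce
  with q show thesis by (rule that)
next
  case False
  \<comment> \<open>The commutator is twice the cross product of \<open>x\<close> and
    \<open>y\<close>.\<close>
  define q where "q = x * y - y * x"
  have x: "qre x = 0" and y: "qre y = 0" using assms by (auto simp: imag_units_iff)
  have "q \<noteq> 0" using False by (simp add: q_def)
  then obtain t where t: "qnorm (qscale t q) = 1" by (rule normalize_exists)
  have "q * x = x * y * x - y * (x * x)" "x * q = (x * x) * y - x * y * x"
    "q * y = x * (y * y) - y * x * y" "y * q = y * x * y - (y * y) * x"
    by (simp_all add: q_def left_diff_distrib right_diff_distrib mult.assoc)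
  then have "q * x = - (x * q)" "q * y = - (y * q)"
    using assms by (simp_all add: imag_units_sq)
  then have "qscale t q * x = - (x * qscale t q)" "qscale t q * y = - (y * qscale t q)"
    by (simp_all add: qscale_mult qscale_uminus)
  moreover have "qscale t q \<in> imag_units"
    using t x y by (auto simp: imag_units_iff q_def)
  ultimately show thesis using that by blast
qed

text \<open>A rotation about \<open>x\<close> takes \<open>r\<close> to \<open>s\<close>. Up to
  scale it is \<open>g = 1 - s * r\<close>, because \<open>g * r\<close> and \<open>s * g\<close>
  both equal \<open>r + s\<close>, and \<open>s * r\<close> commutes with \<open>x\<close> since
  both factors anticommute with it. This \<open>g\<close> vanishes when \<open>s = - r\<close>;
  there the half turn \<open>x\<close> does the job.\<close>

lemma imag_units_conjugate:
  assumes "r \<in> imag_units" "s \<in> imag_units" "x \<in> imag_units"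
    and "r * x = - (x * r)" "s * x = - (x * s)"
  obtains g where "qnorm g = 1" "g * r = s * g" "g * x = x * g"
proof (cases "s = - r")
  case True
  show thesis
    by (rule that[of x]) (use assms True in \<open>auto simp: imag_units_norm\<close>)
next
  case False
  define g where "g = 1 - s * r"
  have "g \<noteq> 0"
  proof
    assume "g = 0"
    then have "s * r = 1" by (simp add: g_def)
    then have "s = inverse r" by (metis inverse_unique inverse_inverse_eq)
    with False assms show False by (simp add: imag_units_inverse)
  qed
  then obtain t where t: "qnorm (qscale t g) = 1" by (rule normalize_exists)
  have "g * r = r + s" using imag_units_sq[OF assms(1)]
    by (simp add: g_def left_diff_distrib mult.assoc)
  moreover have "s * g = s + r" using imag_units_sq[OF assms(2)]
    by (simp add: g_def right_diff_distrib flip: mult.assoc)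
  moreover have "s * r * x = x * (s * r)"
    using assms by (metis minus_mult_left minus_mult_right minus_minus mult.assoc)
  then have "g * x = x * g" by (simp add: g_def left_diff_distrib right_diff_distrib mult.assoc)
  ultimately show thesis
    by (intro that[of "qscale t g"]) (use t in \<open>simp_all add: qscale_mult add.commute\<close>)
qed

section \<open>Orbits of rotation axes\<close>

locale unit_group =
  fixes H :: "quat set"
  assumes fin: "finite H" and one: "1 \<in> H"
    and mult: "g \<in> H \<Longrightarrow> h \<in> H \<Longrightarrow> g * h \<in> H"
    and inv: "h \<in> H \<Longrightarrow> inverse h \<in> H"
    and norm: "h \<in> H \<Longrightarrow> qnorm h = 1"

definition stab :: "quat set \<Rightarrow> quat \<Rightarrow> quat set" where
  "stab H u = {h \<in> H. h * u = u * h}"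

definition orb :: "quat set \<Rightarrow> quat \<Rightarrow> quat set" where
  "orb H u = (\<lambda>h. h * u * inverse h) ` H"

text \<open>The poles \<open>u\<close> and \<open>- u\<close> are the two ends of one rotation axis
  and are counted separately.\<close>

definition poles :: "quat set \<Rightarrow> quat set" where
  "poles H = {u \<in> imag_units. \<exists>h\<in>H. h \<noteq> 1 \<and> h \<noteq> - 1 \<and> h * u = u * h}"

lemma conj_eq_iff: "a \<noteq> 0 \<Longrightarrow> a * u * inverse a = v \<longleftrightarrow> a * u = v * a"
  for a :: "'a :: division_ring"
  by (metis mult.assoc left_inverse mult.right_neutral right_inverse)

lemma conj_mult: "a \<noteq> 0 \<Longrightarrow> a * u * inverse a * (a * v * inverse a) = a * (u * v) * inverse a"
  for a :: "'a :: division_ring"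
  by (metis mult.assoc left_inverse mult.left_neutral)

lemma conj_imag_units:
  assumes "a \<noteq> 0"
  shows "a * u * inverse a \<in> imag_units \<longleftrightarrow> u \<in> imag_units"
proof -
  have "a * u * inverse a * (a * u * inverse a) = a * (u * u) * inverse a"
    using assms by (rule conj_mult)
  then show ?thesis
    using assms conj_eq_iff[OF assms, of "u * u" "-1"] mult_left_cancel[OF assms, of "u * u" "-1"]
    by (auto simp: imag_units_def)
qed

lemma even_card_uminus_closed:
  fixes A :: "quat set"
  assumes "finite A" "0 \<notin> A" "\<And>a. a \<in> A \<Longrightarrow> - a \<in> A"
  shows "even (card A)"
proof -
  let ?P = "(\<lambda>a. {a, - a}) ` A"
  have "2 * card ?P = card (\<Union>?P)"
  proof (rule card_partition)
    show "finite ?P" "finite (\<Union>?P)" using assms by auto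
    show "card c = 2" if c: "c \<in> ?P" for c
    proof -
      obtain a where a: "a \<in> A" "c = {a, - a}" using c by auto
      then have "- a \<noteq> a" using assms(2) quat_uminus_neq by metis
      then show ?thesis using a by simp
    qed
    show "c1 \<inter> c2 = {}" if "c1 \<in> ?P" "c2 \<in> ?P" "c1 \<noteq> c2" for c1 c2
      using that by (auto simp: minus_equation_iff)
  qed
  moreover have "\<Union>?P = A" using assms by auto
  ultimately show ?thesis by (metis dvd_triv_left)
qed

section \<open>Orbit counting\<close>

context unit_group
begin

lemma nonzero: "h \<in> H \<Longrightarrow> h \<noteq> 0"
  using norm qnorm_1_nonzero by blast

lemma orb_refl: "u \<in> orb H u"
  using one by (force simp: orb_def)

lemma orb_sub:
  assumes "v \<in> orb H u"
  shows "orb H v \<subseteq> orb H u"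
proof
  fix w assume "w \<in> orb H v"
  then obtain h k where hk: "h \<in> H" "k \<in> H" "v = k * u * inverse k" "w = h * v * inverse h"
    using assms by (auto simp: orb_def)
  then have "w = (h * k) * u * inverse (h * k)"
    using nonzero by (simp add: nonzero_inverse_mult_distrib mult.assoc)
  then show "w \<in> orb H u" using hk mult by (auto simp: orb_def)
qed

lemma orb_sym:
  assumes "v \<in> orb H u"
  shows "u \<in> orb H v"
proof -
  obtain k where k: "k \<in> H" "v = k * u * inverse k" using assms by (auto simp: orb_def)
  then have "u = inverse k * v * inverse (inverse k)"
    using nonzero[OF k(1)] by (simp add: mult.assoc) (simp flip: mult.assoc)
  then show ?thesis unfolding orb_def using inv[OF k(1)] by (rule image_eqI)
qed

lemma orb_eq: "v \<in> orb H u \<Longrightarrow> orb H v = orb H u"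
  using orb_sub orb_sym by blast

lemma finite_orb: "finite (orb H u)"
  using fin by (simp add: orb_def)

lemma orbit_stabilizer: "card (orb H u) * card (stab H u) = card H"
proof -
  let ?g = "\<lambda>h. h * u * inverse h"
  have "card {h \<in> H. ?g h = v} = card (stab H u)" if v: "v \<in> ?g ` H" for v
  proof -
    obtain k where k: "k \<in> H" "v = ?g k" using v by auto
    note k0 = nonzero[OF k(1)]
    have "bij_betw (\<lambda>h. k * h) (stab H u) {h \<in> H. ?g h = v}"
    proof (rule bij_betwI[of _ _ _ "\<lambda>h. inverse k * h"])
      show "(\<lambda>h. k * h) \<in> stab H u \<rightarrow> {h \<in> H. ?g h = v}"
      proof
        fix h assume h: "h \<in> stab H u"
        then have hH: "h \<in> H" "h * u = u * h" by (auto simp: stab_def)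
        have "k * h * u = v * (k * h)"
          using hH(2) k k0 by (simp add: mult.assoc) (metis left_inverse mult.assoc mult_1)
        moreover have "k * h \<in> H" using k hH mult by blast
        ultimately show "k * h \<in> {h \<in> H. ?g h = v}" using conj_eq_iff nonzero by blast
      qed
      show "(\<lambda>h. inverse k * h) \<in> {h \<in> H. ?g h = v} \<rightarrow> stab H u"
      proof
        fix h assume "h \<in> {h \<in> H. ?g h = v}"
        then have h: "h \<in> H" "h * u = k * u * inverse k * h"
          using conj_eq_iff[OF nonzero] k by auto
        then have "inverse k * h * u = u * (inverse k * h)"
          using k0 by (simp add: mult.assoc) (metis left_inverse mult.assoc mult_1)
        then show "inverse k * h \<in> stab H u" using h k mult inv by (simp add: stab_def)
      qed
      show "inverse k * (k * h) = h" "k * (inverse k * h) = h" for h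
        using k0 by (simp_all flip: mult.assoc)
    qed
    then show ?thesis by (simp add: bij_betw_same_card)
  qed
  then have "(\<Sum>v\<in>?g ` H. \<Sum>h\<in>{h \<in> H. ?g h = v}. 1) = card (?g ` H) * card (stab H u)"
    by simp
  moreover have "(\<Sum>h\<in>H. 1) = (\<Sum>v\<in>?g ` H. \<Sum>h\<in>{h \<in> H. ?g h = v}. (1::nat))"
    by (rule sum.image_gen[OF fin])
  ultimately show ?thesis by (simp add: orb_def)
qed

lemma stab_unit_group: "unit_group (stab H u)"
proof
  show "finite (stab H u)" "1 \<in> stab H u" using fin one by (auto simp: stab_def)
  show "g * h \<in> stab H u" if "g \<in> stab H u" "h \<in> stab H u" for g h
    using that mult by (auto simp: stab_def) (metis mult.assoc)
  show "inverse h \<in> stab H u" if "h \<in> stab H u" for h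
    using that inv nonzero[of h]
    by (auto simp: stab_def) (metis mult.assoc left_inverse mult_1 mult_1_right right_inverse)
  show "qnorm h = 1" if "h \<in> stab H u" for h
    using that norm by (auto simp: stab_def)
qed

end

text \<open>Once \<open>H\<close> contains \<open>- 1\<close>, it is the full preimage of its
  rotation group, so group orders here are twice those of rotation groups.\<close>

locale unit_group_neg = unit_group +
  assumes neg_one: "- 1 \<in> H"
begin

lemma uminus: "h \<in> H \<Longrightarrow> - h \<in> H"
  using mult[OF neg_one] by fastforce

lemma one_neq: "(1::quat) \<noteq> - 1"
  by (simp add: quat_eq_iff)

lemma even_card_stab: "even (card (stab H u))"
  by (rule even_card_uminus_closed) (use fin uminus nonzero in \<open>auto simp: stab_def\<close>)

lemma pole_iff: "u \<in> poles H \<longleftrightarrow> u \<in> imag_units \<and> card (stab H u) \<ge> 4"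
proof -
  have f: "finite (stab H u)" and s: "{1, - 1} \<subseteq> stab H u" and c: "card {1, - 1 :: quat} = 2"
    using fin one neg_one one_neq by (auto simp: stab_def)
  show ?thesis
  proof
    assume u: "u \<in> poles H"
    then obtain h where "h \<in> stab H u" "h \<notin> {1, - 1}" by (auto simp: poles_def stab_def)
    then have "{1, - 1} \<subset> stab H u" using s by blast
    then have "card (stab H u) > 2" using psubset_card_mono[OF f] c by metis
    moreover have "card (stab H u) \<noteq> 3" using even_card_stab[of u] by auto
    ultimately show "u \<in> imag_units \<and> card (stab H u) \<ge> 4" using u by (simp add: poles_def)
  next
    assume u: "u \<in> imag_units \<and> card (stab H u) \<ge> 4"
    have "stab H u \<noteq> {1, - 1}" using u c by auto
    then show "u \<in> poles H" using u s by (auto simp: poles_def stab_def)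
  qed
qed

lemma commuting_poles:
  assumes "h \<in> H" "h \<noteq> 1" "h \<noteq> - 1"
  shows "card {u \<in> poles H. h * u = u * h} = 2"
proof -
  obtain u where u: "u \<in> imag_units" "h * u = u * h" using axis_exists assms norm by metis
  have "{v \<in> poles H. h * v = v * h} = {u, - u}"
  proof
    show "{u, - u} \<subseteq> {v \<in> poles H. h * v = v * h}"
      using u assms by (auto simp: poles_def)
    show "{v \<in> poles H. h * v = v * h} \<subseteq> {u, - u}"
    proof
      fix v assume "v \<in> {v \<in> poles H. h * v = v * h}"
      then have v: "v \<in> imag_units" "h * v = v * h" by (auto simp: poles_def)
      have "u * v = v * u" using axis_commute[OF norm assms(2,3) u v(2)] assms(1) by simp
      then show "v \<in> {u, - u}" using imag_units_commute_eq u v by blast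
    qed
  qed
  then show ?thesis using quat_uminus_neq[OF imag_units_nonzero[OF u(1)]] by (auto simp: card_2_iff)
qed

lemma finite_poles: "finite (poles H)"
proof -
  have "poles H \<subseteq> (\<Union>h\<in>H - {1, - 1}. {u \<in> poles H. h * u = u * h})"
    by (auto simp: poles_def)
  moreover have "finite {u \<in> poles H. h * u = u * h}" if "h \<in> H - {1, - 1}" for h
    using commuting_poles[of h] that card.infinite by fastforce
  ultimately show ?thesis using fin by (meson finite_Diff finite_UN_I finite_subset)
qed

lemma card_stab_orb:
  assumes "v \<in> orb H u"
  shows "card (stab H v) = card (stab H u)"
proof -
  have "card (orb H u) * card (stab H v) = card (orb H u) * card (stab H u)"
    using orbit_stabilizer[of u] orbit_stabilizer[of v] orb_eq[OF assms] by simp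
  moreover have "card (orb H u) \<noteq> 0" using finite_orb orb_refl by auto
  ultimately show ?thesis by simp
qed

lemma orb_poles:
  assumes "u \<in> poles H"
  shows "orb H u \<subseteq> poles H"
proof
  fix v assume v: "v \<in> orb H u"
  then have "v \<in> imag_units"
    using assms conj_imag_units nonzero by (auto simp: orb_def poles_def)
  then show "v \<in> poles H" using assms card_stab_orb[OF v] by (simp add: pole_iff)
qed

text \<open>Double counting of the pairs of a pole \<open>u\<close> and an element \<open>h\<close>
  other than \<open>1\<close>, \<open>- 1\<close> that fixes it: each such \<open>h\<close> fixes
  exactly two poles.\<close>

lemma pole_count: "(\<Sum>u\<in>poles H. card (stab H u) - 2) = 2 * (card H - 2)"
proof -
  have c: "card (H - {1, - 1}) = card H - 2" "card (stab H u - {1, - 1}) = card (stab H u) - 2" for u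
  proof -
    have "card {1, - 1 :: quat} = 2" using one_neq by (simp add: card_2_iff)
    moreover have "{1, - 1} \<subseteq> H" "{1, - 1} \<subseteq> stab H u"
      using one neg_one by (auto simp: stab_def)
    ultimately show "card (H - {1, - 1}) = card H - 2"
        "card (stab H u - {1, - 1}) = card (stab H u) - 2"
      by (auto simp: card_Diff_subset)
  qed
  have "(\<Sum>u\<in>poles H. card {h \<in> H - {1, - 1}. h * u = u * h}) = 2 * card (H - {1, - 1})"
    by (rule sum_multicount) (use fin finite_poles commuting_poles in auto)
  moreover have "{h \<in> H - {1, - 1}. h * u = u * h} = stab H u - {1, - 1}" for u
    by (auto simp: stab_def)
  ultimately show ?thesis using c by simp
qed

text \<open>On an orbit \<open>D\<close> all stabilizers have order \<open>card H / card D\<close>,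
  so \<open>D\<close> contributes \<open>card D * (card H / card D - 2)\<close> to
  \<open>pole_count\<close>.\<close>

lemma pole_orbit_count:
  "(\<Sum>D\<in>(orb H ` poles H). card H - 2 * card D) = 2 * (card H - 2)"
proof -
  have "(\<Sum>u\<in>poles H. card (stab H u) - 2)
    = (\<Sum>D\<in>(orb H ` poles H). \<Sum>u\<in>{u \<in> poles H. orb H u = D}. card (stab H u) - 2)"
    by (rule sum.image_gen[OF finite_poles])
  also have "\<dots> = (\<Sum>D\<in>(orb H ` poles H). card H - 2 * card D)"
  proof (rule sum.cong[OF refl])
    fix D assume "D \<in> orb H ` poles H"
    then obtain w where w: "w \<in> poles H" "D = orb H w" by auto
    then have D: "{u \<in> poles H. orb H u = D} = D" using orb_poles orb_eq orb_refl by blast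
    have "(\<Sum>u\<in>D. card (stab H u) - 2) = (\<Sum>u\<in>D. card (stab H w) - 2)"
      by (rule sum.cong) (use w card_stab_orb in auto)
    also have "\<dots> = card D * card (stab H w) - card D * 2"
      by (simp add: right_diff_distrib')
    also have "\<dots> = card H - 2 * card D" using orbit_stabilizer[of w] w by simp
    finally show "(\<Sum>u\<in>{u \<in> poles H. orb H u = D}. card (stab H u) - 2) = card H - 2 * card D"
      by (simp add: D)
  qed
  finally show ?thesis using pole_count by simp
qed

end

text \<open>The orbits \<open>A\<close>, \<open>B\<close>, \<open>C\<close> of rotation axes under the rotation group \<open>H / {1, -1}\<close> of order \<open>N\<close>;
  the axes have orders \<open>2 \<le> q \<le> r\<close> there.\<close>

locale pole_type =
  fixes H :: "quat set" and N q r :: nat and A B C :: "quat set"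
  assumes card_H: "card H = 2 * N"
    and poles_eq: "poles H = A \<union> B \<union> C"
    and disjoint: "A \<inter> B = {}" "A \<inter> C = {}" "B \<inter> C = {}"
    and orb_A: "u \<in> A \<Longrightarrow> orb H u = A" and orb_B: "u \<in> B \<Longrightarrow> orb H u = B"
    and orb_C: "u \<in> C \<Longrightarrow> orb H u = C"
    and stab_A: "u \<in> A \<Longrightarrow> card (stab H u) = 4"
    and stab_B: "u \<in> B \<Longrightarrow> card (stab H u) = 2 * q"
    and stab_C: "u \<in> C \<Longrightarrow> card (stab H u) = 2 * r"
    and card_A: "card A * 2 = N" and card_B: "card B * q = N" and card_C: "card C * r = N"
    and cases: "q = 2 \<and> r \<ge> 2 \<and> N = 2 * r \<or>
      q = 3 \<and> (r = 3 \<and> N = 12 \<or> r = 4 \<and> N = 24 \<or> r = 5 \<and> N = 60)"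

lemmas pole_typeD = pole_type.card_H pole_type.poles_eq pole_type.disjoint
  pole_type.orb_A pole_type.orb_B pole_type.orb_C
  pole_type.stab_A pole_type.stab_B pole_type.stab_C
  pole_type.card_A pole_type.card_B pole_type.card_C pole_type.cases

text \<open>With orbit sizes \<open>N/p\<close>, \<open>N/q\<close>, \<open>N/r\<close> the sum
  condition reads \<open>1/p + 1/q + 1/r = 1 + 2/N\<close>, and the ordering of the sizes means
  \<open>p \<le> q \<le> r\<close>. Having \<open>p \<ge> 3\<close>, or \<open>q \<ge> 4\<close>, or
  \<open>q = 3\<close> with \<open>r \<ge> 6\<close> would push the left side down to at most
  1.\<close>

lemma pole_type_arith:
  fixes a b c p q r N :: nat
  assumes eq: "a * p = N" "b * q = N" "c * r = N" "a + b + c = N + 2"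
    and ge: "p \<ge> 2" "q \<ge> 2" "r \<ge> 2" and ord: "b \<le> a" "c \<le> b" "c > 0"
  shows "p = 2 \<and> (q = 2 \<and> N = 2 * r \<or>
     q = 3 \<and> (r = 3 \<and> N = 12 \<or> r = 4 \<and> N = 24 \<or> r = 5 \<and> N = 60))"
proof -
  have "p < 3"
  proof (rule ccontr)
    assume "\<not> p < 3"
    then have "a * 3 \<le> a * p" by (intro mult_le_mono2) simp
    then show False using eq ord by linarith
  qed
  then have p: "p = 2" using ge by simp
  have N: "N = 2 * a" using eq(1) p by simp
  have "q < 4"
  proof (rule ccontr)
    assume "\<not> q < 4"
    then have "b * 4 \<le> b * q" by (intro mult_le_mono2) simp
    then show False using eq ord N by linarith
  qed
  then consider "q = 2" | "q = 3" using ge by linarith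
  then show ?thesis
  proof cases
    case 1
    then have "c = 2" using eq N by simp
    then show ?thesis using 1 p eq by auto
  next
    case 2
    have c: "3 * c = a + 6" using eq N 2 by simp_all
    have "3 * (c * r) = (a + 6) * r" by (simp add: c flip: mult.assoc)
    then have r: "(a + 6) * r = 6 * a" using eq(3) N by simp
    have "r < 6"
    proof (rule ccontr)
      assume "\<not> r < 6"
      then have "(a + 6) * 6 \<le> (a + 6) * r" by (intro mult_le_mono2) simp
      then show False using r by simp
    qed
    moreover have "r \<noteq> 2"
      using eq 2 p ord by auto
    ultimately consider "r = 3" | "r = 4" | "r = 5" using ge by linarith
    then show ?thesis using r 2 p N by cases auto
  qed
qed

lemma card_3_sorted:
  fixes f :: "'a \<Rightarrow> nat"
  assumes "card S = 3"
  obtains a b c where "S = {a, b, c}" "a \<noteq> b" "a \<noteq> c" "b \<noteq> c" "f b \<le> f a" "f c \<le> f b"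
proof -
  obtain x y z where S: "S = {x, y, z}" "x \<noteq> y" "x \<noteq> z" "y \<noteq> z"
    using assms by (auto simp: card_3_iff)
  then consider "f y \<le> f x" "f z \<le> f y" | "f z \<le> f x" "f y \<le> f z" | "f x \<le> f y" "f z \<le> f x"
    | "f z \<le> f y" "f x \<le> f z" | "f x \<le> f z" "f y \<le> f x" | "f y \<le> f z" "f x \<le> f y"
    by linarith
  then show thesis
  proof cases
    case 1 show thesis by (rule that[of x y z]) (use S 1 in auto)
  next
    case 2 show thesis by (rule that[of x z y]) (use S 2 in auto)
  next
    case 3 show thesis by (rule that[of y x z]) (use S 3 in auto)
  next
    case 4 show thesis by (rule that[of y z x]) (use S 4 in auto)
  next
    case 5 show thesis by (rule that[of z x y]) (use S 5 in auto)
  next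
    case 6 show thesis by (rule that[of z y x]) (use S 6 in auto)
  qed
qed

definition nonabelian :: "quat set \<Rightarrow> bool" where
  "nonabelian H \<longleftrightarrow> (\<exists>g\<in>H. \<exists>h\<in>H. g * h \<noteq> h * g)"

lemma nonabelian_no_axis:
  assumes "nonabelian H" "x \<in> imag_units"
  obtains h where "h \<in> H" "h * x \<noteq> x * h"
  using assms commute_imag_trans unfolding nonabelian_def by metis

context unit_group_neg
begin

text \<open>A pole orbit \<open>D\<close> has \<open>card D \<ge> 2\<close>, as no pole is fixed by
  all of a nonabelian group, and \<open>card D \<le> card H / 4\<close>. Its term in
  \<open>pole_orbit_count\<close> thus lies between \<open>card H / 2\<close> and
  \<open>card H - 4\<close>, and the total \<open>2 * (card H - 2)\<close> leaves room for exactly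
  three orbits. Sorted by size, they satisfy the hypotheses of
  \<open>pole_type_arith\<close>.\<close>

theorem pole_type_exists:
  assumes nonab: "nonabelian H"
  obtains N q r A B C where "pole_type H N q r A B C"
proof -
  let ?O = "orb H ` poles H" and ?h = "card H"
  have cH: "card {1, - 1 :: quat} = 2" using one_neq by (simp add: card_2_iff)
  obtain g h where gh: "g \<in> H" "h \<in> H" "g * h \<noteq> h * g" using nonab by (auto simp: nonabelian_def)
  then have "g \<notin> {1, - 1}" by auto
  then have "{1, - 1} \<subset> H" using gh one neg_one by blast
  then have h2: "?h > 2" using psubset_card_mono[OF fin] cH by metis
  have evH: "even ?h"
    by (rule even_card_uminus_closed) (use fin uminus nonzero in auto)
  have orb_card: "card D \<ge> 2 \<and> 4 * card D \<le> ?h" if D: "D \<in> ?O" for D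
  proof -
    obtain u where u: "u \<in> poles H" "D = orb H u" using D by auto
    have "card D * card (stab H u) = ?h" "card (stab H u) \<ge> 4"
      using orbit_stabilizer u pole_iff by auto
    then have 1: "4 * card D \<le> ?h" by (metis mult.commute mult_le_mono2)
    have ui: "u \<in> imag_units" using u by (simp add: poles_def)
    obtain k where k: "k \<in> H" "k * u \<noteq> u * k" using nonabelian_no_axis[OF nonab ui] .
    then have "k * u * inverse k \<noteq> u" using conj_eq_iff nonzero by blast
    then have "card {u, k * u * inverse k} = 2" by (simp add: card_2_iff)
    moreover have "{u, k * u * inverse k} \<subseteq> D" using orb_refl k u by (auto simp: orb_def)
    moreover have "finite D" using finite_orb u by blast
    ultimately have "card D \<ge> 2" by (metis card_mono)
    with 1 show ?thesis by simp
  qed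
  have finO: "finite ?O" using finite_poles by simp
  note cnt = pole_orbit_count
  have "card ?O \<le> 3"
  proof (rule ccontr)
    assume "\<not> card ?O \<le> 3"
    then have "4 * ?h \<le> card ?O * ?h" by simp
    also have "\<dots> = (\<Sum>D\<in>?O. ?h)" by simp
    also have "\<dots> \<le> (\<Sum>D\<in>?O. 2 * (?h - 2 * card D))"
      by (rule sum_mono) (use orb_card in fastforce)
    also have "\<dots> = 2 * (2 * (?h - 2))" using cnt by (simp flip: sum_distrib_left)
    finally show False using h2 by linarith
  qed
  moreover have "card ?O \<ge> 3"
  proof (rule ccontr)
    assume k: "\<not> card ?O \<ge> 3"
    have "2 * (?h - 2) \<le> (\<Sum>D\<in>?O. ?h - 4)"
      unfolding cnt[symmetric] by (rule sum_mono) (use orb_card in fastforce)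
    also have "\<dots> \<le> 2 * (?h - 4)" using k by simp
    finally show False using h2 by linarith
  qed
  ultimately have "card ?O = 3" by simp
  then obtain A B C where O: "?O = {A, B, C}" "A \<noteq> B" "A \<noteq> C" "B \<noteq> C" "card B \<le> card A" "card C \<le> card B"
    by (rule card_3_sorted)
  define N where "N = ?h div 2"
  have N: "?h = 2 * N" using evH by (simp add: N_def)
  have orbit: "\<exists>n. (\<forall>u\<in>D. orb H u = D \<and> card (stab H u) = 2 * n) \<and> card D * n = N \<and> n \<ge> 2"
    if D: "D \<in> ?O" for D
  proof -
    obtain u where u: "u \<in> poles H" "D = orb H u" using D by auto
    obtain n where n: "card (stab H u) = 2 * n" using even_card_stab by (metis evenE)
    have "\<forall>v\<in>D. orb H v = D \<and> card (stab H v) = 2 * n"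
      using u n orb_eq card_stab_orb by auto
    moreover have "card D * n = N" using orbit_stabilizer[of u] N n u by simp
    moreover have "n \<ge> 2" using u n pole_iff by simp
    ultimately show ?thesis by blast
  qed
  obtain p where p: "\<forall>u\<in>A. orb H u = A \<and> card (stab H u) = 2 * p" "card A * p = N" "p \<ge> 2"
    using orbit[of A] O by auto
  obtain q where q: "\<forall>u\<in>B. orb H u = B \<and> card (stab H u) = 2 * q" "card B * q = N" "q \<ge> 2"
    using orbit[of B] O by auto
  obtain r where r: "\<forall>u\<in>C. orb H u = C \<and> card (stab H u) = 2 * r" "card C * r = N" "r \<ge> 2"
    using orbit[of C] O by auto
  have "card A \<le> N \<and> card B \<le> N \<and> card C \<le> N"
    using orb_card[of A] orb_card[of B] orb_card[of C] O(1) N by auto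
  moreover have "(2 * N - 2 * card A) + (2 * N - 2 * card B) + (2 * N - 2 * card C) = 2 * (2 * N - 2)"
    using cnt O(2-4) unfolding O(1) N by simp
  ultimately have sum: "card A + card B + card C = N + 2" using h2 N by linarith
  have "card C > 0" using orb_card[of C] O by auto
  then have T: "p = 2 \<and> (q = 2 \<and> N = 2 * r \<or>
     q = 3 \<and> (r = 3 \<and> N = 12 \<or> r = 4 \<and> N = 24 \<or> r = 5 \<and> N = 60))"
    using pole_type_arith[OF p(2) q(2) r(2) sum p(3) q(3) r(3)] O by blast
  have "poles H = \<Union>?O" using orb_poles orb_refl by blast
  then have "poles H = A \<union> B \<union> C" using O by auto
  moreover have "A \<inter> B = {}" "A \<inter> C = {}" "B \<inter> C = {}" using p(1) q(1) r(1) O(2-4) by blast+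
  ultimately have "pole_type H N q r A B C"
    using p q r T N by unfold_locales auto
  then show thesis by (rule that)
qed

end

section \<open>Generating finite groups of unit quaternions\<close>

text \<open>Words without inverses. For \<open>S\<close> closed under inverses inside a finite group
  they already form a subgroup, as in \<open>unit_group_gen\<close>.\<close>

inductive_set gen :: "quat set \<Rightarrow> quat set" for S where
  one: "1 \<in> gen S"
| step: "s \<in> S \<Longrightarrow> g \<in> gen S \<Longrightarrow> s * g \<in> gen S"

lemma gen_incl: "s \<in> S \<Longrightarrow> s \<in> gen S"
  using gen.step[OF _ gen.one] by fastforce

lemma gen_mult: "g \<in> gen S \<Longrightarrow> h \<in> gen S \<Longrightarrow> g * h \<in> gen S"
  by (induction rule: gen.induct) (auto simp: mult.assoc intro: gen.step)

context unit_group
begin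

lemma gen_subset:
  assumes "S \<subseteq> H"
  shows "gen S \<subseteq> H"
proof
  show "g \<in> H" if "g \<in> gen S" for g
    using that by induction (use assms one mult in auto)
qed

lemma unit_group_gen:
  assumes S: "S \<subseteq> H" "\<And>s. s \<in> S \<Longrightarrow> inverse s \<in> S"
  shows "unit_group (gen S)"
proof
  show "finite (gen S)" using gen_subset[OF S(1)] fin by (rule finite_subset)
  show "1 \<in> gen S" by (rule gen.one)
  show "g * h \<in> gen S" if "g \<in> gen S" "h \<in> gen S" for g h using that by (rule gen_mult)
  show "qnorm h = 1" if "h \<in> gen S" for h using that gen_subset[OF S(1)] norm by blast
  show "inverse h \<in> gen S" if "h \<in> gen S" for h
    using that
  proof induction
    case one
    show ?case by (simp add: gen.one)
  next
    case (step s g)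
    have "s \<noteq> 0" "g \<noteq> 0" using step nonzero S gen_subset[OF S(1)] by blast+
    then show ?case
      using step S gen_mult gen_incl by (simp add: nonzero_inverse_mult_distrib)
  qed
qed

lemma abelian_axis:
  assumes "\<not> nonabelian H"
  obtains x where "x \<in> imag_units" "\<And>h. h \<in> H \<Longrightarrow> h * x = x * h"
proof (cases "H \<subseteq> {1, - 1}")
  case True
  have "Quat 0 1 0 0 \<in> imag_units" by (simp add: imag_units_iff qnorm_def)
  moreover have "h * Quat 0 1 0 0 = Quat 0 1 0 0 * h" if "h \<in> H" for h using that True by auto
  ultimately show thesis by (rule that)
next
  case False
  then obtain h where h: "h \<in> H" "h \<noteq> 1" "h \<noteq> - 1" by blast
  obtain x where x: "x \<in> imag_units" "h * x = x * h" using axis_exists h norm by metis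
  have "k * x = x * k" if "k \<in> H" for k
    using axis_commute[OF norm[OF h(1)] h(2,3) x] that h assms by (auto simp: nonabelian_def)
  with x(1) show thesis by (rule that)
qed

end

section \<open>Small stabilizers and the element -1\<close>

lemma stab_uminus: "stab H (- u) = stab H u"
  by (auto simp: stab_def)

context unit_group_neg
begin

lemma uminus_pole: "- u \<in> poles H \<longleftrightarrow> u \<in> poles H"
  by (simp add: pole_iff stab_uminus)

lemma pole_type_N_pos:
  assumes "pole_type H N q r A B C"
  shows "N > 0" "A \<noteq> {}" "B \<noteq> {}" "C \<noteq> {}" "finite A" "finite B" "finite C"
    "A \<subseteq> poles H" "B \<subseteq> poles H" "C \<subseteq> poles H"
proof -
  note D = pole_typeD[OF assms]
  have "card H > 0" using fin one by (auto simp: card_gt_0_iff)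
  then show 0: "N > 0" using D(1) by simp
  show "A \<noteq> {}" "B \<noteq> {}" "C \<noteq> {}" using 0 D(12-14) by auto
  show "A \<subseteq> poles H" "B \<subseteq> poles H" "C \<subseteq> poles H" using D(2) by auto
  then show "finite A" "finite B" "finite C" using finite_poles finite_subset by blast+
qed

text \<open>For \<open>h\<close> in the stabilizer other than \<open>1\<close>, \<open>- 1\<close>,
  the four elements are \<open>1\<close>, \<open>- 1\<close>, \<open>h\<close>, \<open>- h\<close>.
  The square \<open>h * h\<close> is one of them, and only \<open>- 1\<close> is possible, so
  \<open>h\<close> is itself an imaginary unit and equals \<open>u\<close> up to sign.\<close>

lemma stab_4:
  assumes u: "u \<in> imag_units" and c: "card (stab H u) = 4"
  shows "u \<in> H" "stab H u = {1, - 1, u, - u}"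
proof -
  interpret S: unit_group "stab H u" by (rule stab_unit_group)
  have "u \<in> poles H" using u c pole_iff by simp
  then obtain h where h: "h \<in> H" "h \<noteq> 1" "h \<noteq> - 1" "h * u = u * h" by (auto simp: poles_def)
  have d: "h \<noteq> - h" using quat_uminus_neq nonzero h by metis
  have s: "{1, - 1, h, - h} \<subseteq> stab H u"
    using h one neg_one uminus by (auto simp: stab_def)
  moreover have "card {1, - 1, h, - h} = 4"
    using h d one_neq by (auto simp: card_insert_if minus_equation_iff)
  ultimately have e: "stab H u = {1, - 1, h, - h}"
    using c S.fin card_subset_eq by metis
  have "h * h \<in> stab H u" using s S.mult by blast
  then have "h * h = 1 \<or> h * h = - 1 \<or> h * h = h * 1 \<or> h * h = h * (- 1)" using e by simp
  moreover have "h * h \<noteq> 1" using h by (simp add: square_eq_1_iff)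
  moreover have "h * h \<noteq> h * 1" "h * h \<noteq> h * (- 1)"
    using h nonzero mult_left_cancel by blast+
  ultimately have "h \<in> imag_units" by (auto simp: imag_units_def)
  then have "u = h \<or> u = - h" using imag_units_commute_eq u h by blast
  then show "u \<in> H" "stab H u = {1, - 1, u, - u}" using e h uminus by auto
qed

end

context unit_group
begin

text \<open>Adjoining \<open>- 1\<close> makes the classification available. In the enlarged group
  every type has poles with stabilizer of order 4, which are elements with square
  \<open>- 1\<close>. Such an element or its negative lies in \<open>H\<close>, and
  \<open>- 1\<close> is its square.\<close>

lemma nonabelian_neg_one:
  assumes "nonabelian H"
  shows "- 1 \<in> H"
proof -
  let ?K = "H \<union> uminus ` H"
  interpret K: unit_group_neg ?K
  proof
    show "finite ?K" "1 \<in> ?K" "- 1 \<in> ?K" using fin one by auto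
    show "g * h \<in> ?K" if "g \<in> ?K" "h \<in> ?K" for g h
      using that mult by fastforce
    show "inverse h \<in> ?K" if "h \<in> ?K" for h using that inv nonzero
      by (auto simp: nonzero_inverse_minus_eq)
    show "qnorm h = 1" if "h \<in> ?K" for h using that norm by auto
  qed
  have "nonabelian ?K" using assms by (auto simp: nonabelian_def)
  then obtain N q r A B C where T: "pole_type ?K N q r A B C" by (rule K.pole_type_exists)
  then obtain u where u: "u \<in> A" using K.pole_type_N_pos(2) by blast
  then have "u \<in> imag_units" "card (stab ?K u) = 4"
    using K.pole_type_N_pos(8)[OF T] pole_typeD(9)[OF T] by (auto simp: poles_def)
  then have "u \<in> ?K" "u * u = - 1" using K.stab_4 by (auto simp: imag_units_def)
  then obtain h where "h \<in> H" "h * h = - 1" by auto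
  then show ?thesis using mult by metis
qed

end

context unit_group_neg
begin

text \<open>The subgroup \<open>K\<close> generated by the stabilizers of a pole in \<open>C\<close>
  and a non-opposite pole in \<open>B\<close> has the same stabilizers at these two poles. It is
  nonabelian and so has a type of its own; comparing the two types forces equal orders.\<close>

lemma generated_by_two_stabilizers:
  assumes nonab: "nonabelian H"
  obtains x y where "x \<in> imag_units" "y \<in> imag_units" "H \<subseteq> gen (stab H x \<union> stab H y)"
proof -
  obtain N q r A B C where T: "pole_type H N q r A B C" using nonab by (rule pole_type_exists)
  note TD = pole_typeD[OF T] and P = pole_type_N_pos[OF T]
  obtain x where x: "x \<in> C" using P by blast
  have "card B \<ge> 2" using TD(13,15) by auto
  then have "\<not> B \<subseteq> {- x}" using card_mono[of "{- x}" B] by auto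
  then obtain y where y: "y \<in> B" "y \<noteq> - x" by blast
  then have yx: "y \<noteq> x" using x TD(5) by blast
  have xp: "x \<in> poles H" and yp: "y \<in> poles H" using x y P by auto
  then have xi: "x \<in> imag_units" and yi: "y \<in> imag_units" by (auto simp: poles_def)
  define K where "K = gen (stab H x \<union> stab H y)"
  interpret SX: unit_group "stab H x" by (rule stab_unit_group)
  interpret SY: unit_group "stab H y" by (rule stab_unit_group)
  have sub: "stab H x \<union> stab H y \<subseteq> H" by (auto simp: stab_def)
  have KH: "K \<subseteq> H" unfolding K_def by (rule gen_subset[OF sub])
  have sK: "stab H x \<subseteq> K" "stab H y \<subseteq> K" unfolding K_def using gen_incl by auto
  have "unit_group K" unfolding K_def
    by (rule unit_group_gen[OF sub]) (use SX.inv SY.inv in auto)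
  moreover have "- 1 \<in> K" using sK neg_one by (auto simp: stab_def)
  ultimately interpret K: unit_group_neg K
    by (simp add: unit_group_neg_def unit_group_neg_axioms_def)
  have sx: "stab K x = stab H x" and sy: "stab K y = stab H y"
    using KH sK by (auto simp: stab_def)
  have "nonabelian K"
  proof (rule ccontr)
    \<comment> \<open>Commuting nontrivial elements share their axis, so \<open>x\<close> and
      \<open>y\<close> would lie on one line.\<close>
    assume ab: "\<not> nonabelian K"
    obtain h k where h: "h \<in> stab H x" "h \<noteq> 1" "h \<noteq> - 1" and k: "k \<in> stab H y" "k \<noteq> 1" "k \<noteq> - 1"
      using xp yp by (auto simp: poles_def stab_def)
    have hk: "h * k = k * h" using h k sK ab by (auto simp: nonabelian_def)
    have "h * x = x * h" "k * y = y * k" using h k by (auto simp: stab_def)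
    have "k * x = x * k"
      using axis_commute[OF SX.norm[OF h(1)] h(2,3) xi \<open>h * x = x * h\<close> hk] .
    from axis_commute[OF SY.norm[OF k(1)] k(2,3) yi \<open>k * y = y * k\<close> this]
    show False using imag_units_commute_eq[OF xi yi] y yx by blast
  qed
  then obtain N' q' r' A' B' C' where T': "pole_type K N' q' r' A' B' C'" by (rule K.pole_type_exists)
  note TD' = pole_typeD[OF T'] and P' = K.pole_type_N_pos[OF T']
  have cx: "card (stab K x) = 2 * r" and cy: "card (stab K y) = 2 * q"
    using sx sy TD(10)[OF y(1)] TD(11)[OF x] by simp_all
  have xpK: "x \<in> poles K" and ypK: "y \<in> poles K"
    using xi yi cx cy TD(15) by (auto simp: K.pole_iff)
  have NN: "N' \<le> N" using card_mono[OF fin KH] TD(1) TD'(1) by simp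
  have rx: "r = 2 \<or> r = q' \<or> r = r'" using xpK cx TD'(2,9-11) by fastforce
  note n' = TD'(15)
  have "N' = N"
  proof (cases "q = 2")
    case True
    then have "N = 2 * r" using TD(15) by auto
    then show ?thesis using n' rx NN by (elim disjE conjE; linarith)
  next
    case q: False
    then have q3: "q = 3" and rr: "r = 3 \<and> N = 12 \<or> r = 4 \<and> N = 24 \<or> r = 5 \<and> N = 60" using TD(15) by auto
    \<comment> \<open>If \<open>K\<close> were dihedral, every pole with stabilizer of order above 4
      would lie in the two-element orbit \<open>C'\<close>, but \<open>x\<close>, \<open>- x\<close>
      and \<open>y\<close> are three such poles.\<close>
    have "q' = 3"
    proof (rule ccontr)
      assume "q' \<noteq> 3"
      then have q': "q' = 2" "N' = 2 * r'" using n' by auto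
      have pK: "poles K = A' \<union> B' \<union> C'" "\<forall>u\<in>A' \<union> B'. card (stab K u) = 4"
        using TD'(2,9,10) q'(1) by auto
      have C': "u \<in> C'" if "u \<in> poles K" "card (stab K u) \<noteq> 4" for u
        using that pK by blast
      have xC: "x \<in> C'" using C'[OF xpK] cx rr by linarith
      have yC: "y \<in> C'" using C'[OF ypK] cy q3 by linarith
      have "- x \<in> poles K" "card (stab K (- x)) = 2 * r"
        using xpK cx K.uminus_pole stab_uminus by auto
      then have "- x \<in> C'" using C' rr by fastforce
      then have "{x, - x, y} \<subseteq> C'" using xC yC by blast
      moreover have "card {x, - x, y} = 3"
        using quat_uminus_neq[OF imag_units_nonzero[OF xi]] y yx by auto
      ultimately have "3 \<le> card C'" using P' card_mono by metis
      moreover have "card C' * r' = N'" by (rule TD'(14))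
      moreover have "r' > 0" using q' P'(1) by simp
      ultimately show False using q' by simp
    qed
    then show ?thesis using n' rx rr NN by (elim disjE conjE; linarith)
  qed
  then have "K = H" using card_subset_eq[OF fin KH] TD(1) TD'(1) by simp
  then show thesis using that xi yi K_def by blast
qed

end

text \<open>If \<open>q\<close> is orthogonal to \<open>1\<close> and to the generators \<open>s\<close>, then \<open>q\<close> inverts every generator,
  and all \<open>q * s\<close> are square roots of \<open>-1\<close>.\<close>

theorem (in unit_group) orthogonal_generators:
  obtains q S where "q \<in> imag_units" "S \<subseteq> H" "H \<subseteq> gen S" "\<And>s. s \<in> S \<Longrightarrow> q * s \<in> imag_units"
proof (cases "nonabelian H")
  case True
  interpret unit_group_neg H
    by unfold_locales (rule nonabelian_neg_one[OF True])
  obtain x y where xy: "x \<in> imag_units" "y \<in> imag_units" "H \<subseteq> gen (stab H x \<union> stab H y)"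
    using True by (rule generated_by_two_stabilizers)
  obtain q where q: "q \<in> imag_units" "q * x = - (x * q)" "q * y = - (y * q)"
    using orthogonal_imag_exists2[OF xy(1,2)] .
  show thesis
  proof (rule that[OF q(1) _ xy(3)])
    show "stab H x \<union> stab H y \<subseteq> H" by (auto simp: stab_def)
    show "q * s \<in> imag_units" if "s \<in> stab H x \<union> stab H y" for s
      using that anticommute_imag_mult[OF xy(1) q(1,2)] anticommute_imag_mult[OF xy(2) q(1,3)] norm
      by (auto simp: stab_def)
  qed
next
  case False
  then obtain x where x: "x \<in> imag_units" "\<And>h. h \<in> H \<Longrightarrow> h * x = x * h"
    by (rule abelian_axis) blast
  obtain q where q: "q \<in> imag_units" "q * x = - (x * q)" using orthogonal_imag_exists[OF x(1)] .
  show thesis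
    by (rule that[OF q(1) subset_refl])
      (use gen_incl anticommute_imag_mult[OF x(1) q x(2)] norm in auto)
qed

section \<open>Uniqueness of the coset of reflections\<close>

lemma conj_uminus_cases:
  fixes q x :: quat
  assumes "q \<noteq> 0" "q * x * inverse q \<in> {x, - x}"
  shows "q * x = x * q \<or> q * x = - (x * q)"
  using assms conj_eq_iff[OF assms(1)] by fastforce

lemma semicommute_mult:
  fixes a b x :: "'a :: semigroup_mult"
  assumes "a * x = x * a'" "b * x = x * b'"
  shows "a * b * x = x * (a' * b')"
proof -
  have "a * b * x = a * (b * x)" by (rule mult.assoc)
  also have "\<dots> = a * x * b'" unfolding assms(2) by (rule mult.assoc[symmetric])
  also have "\<dots> = x * (a' * b')" unfolding assms(1) by (rule mult.assoc)
  finally show ?thesis .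
qed

lemma sign_commute_mult:
  fixes a b x :: quat
  assumes "a * x = x * a \<or> a * x = - (x * a)" "b * x = x * b \<or> b * x = - (x * b)"
  shows "a * b * x = x * (a * b) \<or> a * b * x = - (x * (a * b))"
proof -
  have "a * x = x * a \<or> a * x = x * - a" "b * x = x * b \<or> b * x = x * - b"
    using assms by simp_all
  then obtain a' b' where "a' = a \<or> a' = - a" "b' = b \<or> b' = - b"
    and ab: "a * x = x * a'" "b * x = x * b'" by blast
  then show ?thesis using semicommute_mult[OF ab] by auto
qed

text \<open>Since \<open>(i r) (i s) = - (r s)\<close>, these are the products of evenly many of the reflections \<open>i r\<close>.\<close>

inductive_set evens :: "quat set \<Rightarrow> quat set" for R where
  one: "1 \<in> evens R"
| step: "r \<in> R \<Longrightarrow> s \<in> R \<Longrightarrow> a \<in> evens R \<Longrightarrow> - (r * s * a) \<in> evens R"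

text \<open>A step contributes two anticommuting factors, whose signs cancel.\<close>

lemma evens_commute:
  assumes "a \<in> evens R" "\<And>r. r \<in> R \<Longrightarrow> r * z = - (z * r)"
  shows "a * z = z * a"
  using assms(1)
proof induction
  case (step r s a)
  have "r * z = z * - r" "s * z = z * - s" using step assms(2) by simp_all
  then have "r * s * z = z * (r * s)" using semicommute_mult[of r z "- r" s "- s"] by simp
  then have "r * s * a * z = z * (r * s * a)"
    by (rule semicommute_mult[OF _ step.IH])
  then show ?case by simp
qed simp

text \<open>Conditions on \<open>H\<close> and \<open>Q\<close> for \<open>H \<union> i Q\<close> to be a reflection group.\<close>

locale refl_pair = unit_group +
  fixes Q :: "quat set"
  assumes Q_norm: "q \<in> Q \<Longrightarrow> qnorm q = 1"
    and Q_mult: "q \<in> Q \<Longrightarrow> h \<in> H \<Longrightarrow> q * h \<in> Q"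
    and Q_prod: "p \<in> Q \<Longrightarrow> q \<in> Q \<Longrightarrow> - (p * q) \<in> H"
    and refl_ex: "Q \<inter> imag_units \<noteq> {}"
    and H_evens: "H \<subseteq> evens (Q \<inter> imag_units)"
begin

lemma Q_nonzero: "q \<in> Q \<Longrightarrow> q \<noteq> 0"
  using Q_norm qnorm_1_nonzero by blast

text \<open>Only products \<open>- (p * q)\<close> are known to lie in \<open>H\<close>, so the
  inverse of \<open>p\<close> is replaced by \<open>inverse (p * p) * p\<close>.\<close>

lemma Q_inverse_mult:
  assumes "p \<in> Q" "q \<in> Q"
  shows "inverse p * q \<in> H"
proof -
  have "inverse p * q = inverse (- (p * p)) * (- (p * q))"
    using Q_nonzero[OF assms(1)]
    by (simp add: nonzero_inverse_minus_eq nonzero_inverse_mult_distrib mult.assoc)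
      (simp flip: mult.assoc)
  then show ?thesis using assms Q_prod inv mult by metis
qed

lemma Q_mult_inverse:
  assumes "p \<in> Q" "q \<in> Q"
  shows "p * inverse q \<in> H"
proof -
  have "p * inverse q = - (p * q) * inverse (- (q * q))"
    using Q_nonzero[OF assms(2)]
    by (simp add: nonzero_inverse_minus_eq nonzero_inverse_mult_distrib mult.assoc)
      (simp flip: mult.assoc)
  then show ?thesis using assms Q_prod inv mult by metis
qed

lemma Q_conj: "q \<in> Q \<Longrightarrow> h \<in> H \<Longrightarrow> q * h * inverse q \<in> H"
  using Q_mult Q_mult_inverse by blast

lemma Q_coset:
  assumes "p \<in> Q"
  shows "Q = (*) p ` H"
proof
  show "(*) p ` H \<subseteq> Q" using assms Q_mult by auto
  show "Q \<subseteq> (*) p ` H"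
  proof
    fix q assume "q \<in> Q"
    then have "inverse p * q \<in> H" using assms Q_inverse_mult by blast
    moreover have "q = p * (inverse p * q)" using Q_nonzero[OF assms] by (simp flip: mult.assoc)
    ultimately show "q \<in> (*) p ` H" by blast
  qed
qed

lemma Q_left_mult:
  assumes "h \<in> H" "q \<in> Q"
  shows "h * q \<in> Q"
proof -
  have "inverse (- (q * q)) * - (q * h * q) \<in> H" using assms Q_mult Q_prod inv mult by metis
  moreover have "q * (inverse (- (q * q)) * - (q * h * q)) = h * q"
    using Q_nonzero[OF assms(2)]
    by (simp add: nonzero_inverse_minus_eq nonzero_inverse_mult_distrib mult.assoc)
      (simp flip: mult.assoc)
  ultimately show ?thesis using Q_mult[OF assms(2)] by metis
qed

lemma Q_eq_H_iff: "1 \<in> Q \<longleftrightarrow> Q \<inter> H \<noteq> {}"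
  using one Q_mult inv right_inverse Q_nonzero by (metis IntI disjoint_iff)

text \<open>If all reflections \<open>\<i> r\<close> had \<open>r\<close> anticommuting with
  \<open>x\<close>, then \<open>H\<close>, made of even products, would commute with
  \<open>x\<close> and be abelian. As every element of \<open>Q\<close> commutes or anticommutes
  with \<open>x\<close>, some \<open>s\<close> among these \<open>r\<close> commutes with
  \<open>x\<close>, and then \<open>s\<close> is \<open>x\<close> up to sign.\<close>

lemma axis_in_Q:
  assumes nonab: "nonabelian H" and x: "x \<in> imag_units"
    and H: "\<And>h. h \<in> H \<Longrightarrow> h * x = x * h \<or> h * x = - (x * h)"
    and r: "r \<in> Q" "r * x = x * r \<or> r * x = - (x * r)"
  shows "x \<in> Q"
proof -
  have Q: "q * x = x * q \<or> q * x = - (x * q)" if q: "q \<in> Q" for q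
  proof -
    obtain h where h: "h \<in> H" "q = r * h" using q Q_coset[OF r(1)] by blast
    show ?thesis unfolding h(2) by (rule sign_commute_mult[OF r(2) H[OF h(1)]])
  qed
  have "\<exists>s\<in>Q \<inter> imag_units. s * x \<noteq> - (x * s)"
  proof (rule ccontr)
    assume "\<not> ?thesis"
    then have "h * x = x * h" if "h \<in> H" for h
      using evens_commute[of h _ x] H_evens that by blast
    then show False using nonabelian_no_axis[OF nonab x] by blast
  qed
  then obtain s where s: "s \<in> Q" "s \<in> imag_units" "s * x = x * s" using Q by blast
  then have "x = s \<or> x = - s" using imag_units_commute_eq x by blast
  moreover have "- s \<in> Q" using Q_mult[OF s(1) nonabelian_neg_one[OF nonab]] by simp
  ultimately show ?thesis using s by auto
qed

lemma card_stab_conj: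
  assumes q: "q \<in> Q"
  shows "card (stab H u) \<le> card (stab H (q * u * inverse q))"
proof (rule card_inj_on_le)
  note q0 = Q_nonzero[OF q]
  show "finite (stab H (q * u * inverse q))" using fin by (simp add: stab_def)
  show "inj_on (\<lambda>h. q * h * inverse q) (stab H u)"
    using q0 by (auto intro!: inj_onI)
  show "(\<lambda>h. q * h * inverse q) ` stab H u \<subseteq> stab H (q * u * inverse q)"
  proof
    fix k assume "k \<in> (\<lambda>h. q * h * inverse q) ` stab H u"
    then obtain h where h: "h \<in> H" "h * u = u * h" "k = q * h * inverse q"
      by (auto simp: stab_def)
    then show "k \<in> stab H (q * u * inverse q)"
      using Q_conj[OF q] conj_mult[OF q0] by (simp add: stab_def)
  qed
qed

end

section \<open>The coset of a nonabelian group, type by type\<close>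

locale refl_pair_nonabelian = refl_pair +
  assumes nonab: "nonabelian H"
begin

sublocale unit_group_neg
  by unfold_locales (rule nonabelian_neg_one[OF nonab])

text \<open>For \<open>r \<ge> 3\<close> the two elements of \<open>C\<close> are the only poles
  with stabilizer of order above 4. Both \<open>H\<close> and \<open>Q\<close> therefore preserve
  this axis, and \<open>axis_in_Q\<close> applies.\<close>

lemma dihedral_axis:
  assumes T: "pole_type H N 2 r A B C" and r: "r \<ge> 3" and x: "x \<in> C"
  shows "x \<in> Q"
proof -
  note TD = pole_typeD[OF T] and P = pole_type_N_pos[OF T]
  have xp: "x \<in> poles H" using x P by blast
  have c: "card (stab H x) = 2 * r" using x TD(11) by blast
  have pH: "poles H = A \<union> B \<union> C" "\<forall>u\<in>A \<union> B. card (stab H u) = 4"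
    using TD(2,9,10) by auto
  have C: "u \<in> C" if "u \<in> poles H" "card (stab H u) \<noteq> 4" for u
    using that pH by blast
  have "- x \<in> C" using C xp c r uminus_pole stab_uminus by simp
  moreover have xi: "x \<in> imag_units" using xp by (simp add: poles_def)
  then have "card {x, - x} = 2" using quat_uminus_neq imag_units_nonzero by fastforce
  moreover have "card C = 2"
  proof -
    have "N = 2 * r" using TD(15) by simp
    then show ?thesis using TD(14) r by simp
  qed
  ultimately have Cx: "C = {x, - x}"
    using card_subset_eq[OF P(7), of "{x, - x}"] x by simp
  obtain s where s: "s \<in> Q" using refl_ex by blast
  have "s * x * inverse s \<in> C"
  proof (rule C)
    have "card (stab H (s * x * inverse s)) \<ge> 2 * r" using card_stab_conj[OF s, of x] c by simp
    then show "card (stab H (s * x * inverse s)) \<noteq> 4" "s * x * inverse s \<in> poles H"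
      using r xi conj_imag_units[OF Q_nonzero[OF s]] by (auto simp: pole_iff)
  qed
  then have sx: "s * x = x * s \<or> s * x = - (x * s)"
    using conj_uminus_cases Q_nonzero[OF s] Cx by blast
  show "x \<in> Q"
  proof (rule axis_in_Q[OF nonab xi _ s sx])
    fix h assume h: "h \<in> H"
    then have "h * x * inverse h \<in> orb H x" by (simp add: orb_def)
    then have "h * x * inverse h \<in> {x, - x}" using TD(8)[OF x] Cx by blast
    then show "h * x = x * h \<or> h * x = - (x * h)" by (rule conj_uminus_cases[OF nonzero[OF h]])
  qed
qed

text \<open>This is the quaternion group of order 8, with three axes. A reflection permutes them as
  an involution and so preserves one of them; \<open>axis_in_Q\<close> puts that axis
  \<open>x\<close> into \<open>Q\<close>, and it lies in \<open>H\<close> as well.\<close>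

lemma quaternion_axis:
  assumes T: "pole_type H N 2 2 A B C"
  shows "1 \<in> Q"
proof -
  note TD = pole_typeD[OF T] and P = pole_type_N_pos[OF T]
  have N: "N = 4" using TD(15) by simp
  have c4: "card A = 2" "card B = 2" "card C = 2" using TD(12-14) N by simp_all
  have st: "card (stab H u) = 4" if "u \<in> poles H" for u
    using that TD(2,9-11) by auto
  \<comment> \<open>\<open>u\<close> itself belongs to \<open>H\<close> and permutes the two
    elements of its orbit by conjugation. Fixing \<open>u\<close>, it also fixes the other one,
    which therefore commutes with \<open>u\<close>.\<close>
  have axis: "U = {u, - u}" if U: "U = orb H u" "card U = 2" "u \<in> poles H" for U u
  proof -
    have ui: "u \<in> imag_units" using U by (simp add: poles_def)
    then have uH: "u \<in> H" using stab_4 st U by blast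
    obtain v where v: "v \<in> U" "v \<noteq> u"
      using U(2) by (metis card_2_iff insertI1 insert_commute)
    have "{u, v} = U" using orb_refl U v card_subset_eq[OF finite_orb[of u], of "{u, v}"] by auto
    moreover have "u * v * inverse u \<in> U"
    proof -
      have "U = orb H v" using v U orb_eq by blast
      then show ?thesis using uH by (auto simp: orb_def)
    qed
    moreover have "u * v * inverse u \<noteq> u"
      using v conj_eq_iff[OF imag_units_nonzero[OF ui]] imag_units_nonzero[OF ui] by auto
    ultimately have "u * v * inverse u = v" by blast
    then have "u * v = v * u" using conj_eq_iff[OF imag_units_nonzero[OF ui]] by blast
    moreover have "v \<in> imag_units" using orb_poles[OF U(3)] v U by (auto simp: poles_def)
    ultimately have "v = - u" using imag_units_commute_eq[OF ui] v by blast
    with \<open>{u, v} = U\<close> show ?thesis by simp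
  qed
  obtain a where a: "a \<in> A" using P by blast
  obtain b where b: "b \<in> B" using P by blast
  obtain c where c: "c \<in> C" using P by blast
  have A: "A = {a, - a}" using axis[of A a] a TD(2) TD(6)[OF a] c4 by blast
  have B: "B = {b, - b}" using axis[of B b] b TD(2) TD(7)[OF b] c4 by blast
  have C: "C = {c, - c}" using axis[of C c] c TD(2) TD(8)[OF c] c4 by blast
  have pH: "poles H = {a, - a} \<union> {b, - b} \<union> {c, - c}" using TD(2) A B C by simp
  have dis: "{a, - a} \<inter> {b, - b} = {}" "{a, - a} \<inter> {c, - c} = {}" "{b, - b} \<inter> {c, - c} = {}"
    using TD(3-5) A B C by simp_all
  obtain s where s: "s \<in> Q" "s \<in> imag_units" using refl_ex by blast
  note s0 = imag_units_nonzero[OF s(2)]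
  define f where "f u = s * u * inverse s" for u
  have fp: "f u \<in> poles H" if "u \<in> poles H" for u
    using that card_stab_conj[OF s(1), of u] conj_imag_units[OF s0] by (auto simp: pole_iff f_def)
  have fu: "f (- u) = - f u" for u by (simp add: f_def)
  have "f (f u) = s * s * u * (inverse s * inverse s)" for u by (simp add: f_def mult.assoc)
  then have ff: "f (f u) = u" for u
    using s(2) imag_units_inverse[OF s(2)] by (simp add: imag_units_sq)
  \<comment> \<open>An involution on three axes cannot move all of them.\<close>
  have "f a \<in> {a, - a} \<or> f b \<in> {b, - b} \<or> f c \<in> {c, - c}"
  proof (rule ccontr)
    assume n: "\<not> ?thesis"
    have "f a \<in> poles H" "f b \<in> poles H" "f c \<in> poles H" using pH fp by auto
    then have "f a \<in> {b, - b} \<union> {c, - c}" "f b \<in> {a, - a} \<union> {c, - c}" "f c \<in> {a, - a} \<union> {b, - b}"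
      using n pH by auto
    moreover have swap: "f v \<in> {u, - u}" if "f u \<in> {v, - v}" for u v
    proof -
      have "v = f u \<or> v = - f u" using that by auto
      then show ?thesis using fu ff by auto
    qed
    note swaps = swap[of b a] swap[of c a] swap[of a b] swap[of a c] swap[of b c] swap[of c b]
    ultimately show False
      using swaps dis unfolding disjoint_iff Un_iff by meson
  qed
  then obtain x where x: "x \<in> poles H" "f x \<in> {x, - x}" "orb H x = {x, - x}"
    using pH TD(6)[OF a] TD(7)[OF b] TD(8)[OF c] A B C by blast
  have xi: "x \<in> imag_units" using x by (simp add: poles_def)
  have "x \<in> Q"
  proof (rule axis_in_Q[OF nonab xi _ s(1)])
    show "s * x = x * s \<or> s * x = - (x * s)"
      using x(2) unfolding f_def by (rule conj_uminus_cases[OF s0])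
    fix h assume h: "h \<in> H"
    then have "h * x * inverse h \<in> orb H x" by (simp add: orb_def)
    then show "h * x = x * h \<or> h * x = - (x * h)"
      unfolding x(3) by (rule conj_uminus_cases[OF nonzero[OF h]])
  qed
  moreover have "x \<in> H" using stab_4 st x xi by blast
  ultimately show ?thesis using Q_eq_H_iff by blast
qed

text \<open>Dropping the factor \<open>\<i>\<close> from \<open>H \<union> \<i> Q\<close> changes
  products by a sign only, which is harmless as \<open>- 1\<close> lies in \<open>H\<close>.\<close>

lemma extension_group: "unit_group_neg (H \<union> Q)"
proof
  have Qneg: "- q \<in> Q" if "q \<in> Q" for q using Q_mult[OF that neg_one] by simp
  obtain r where r: "r \<in> Q" using refl_ex by blast
  have "finite Q" using Q_coset[OF r] fin by simp
  then show "finite (H \<union> Q)" using fin by simp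
  show "1 \<in> H \<union> Q" "- 1 \<in> H \<union> Q" using one neg_one by auto
  have "p * q \<in> H" if "p \<in> Q" "q \<in> Q" for p q
    using Q_prod[OF that] uminus by fastforce
  then show "g * h \<in> H \<union> Q" if "g \<in> H \<union> Q" "h \<in> H \<union> Q" for g h
    using that mult Q_mult Q_left_mult by blast
  have "inverse q \<in> Q" if q: "q \<in> Q" for q
  proof -
    have "inverse (- (q * q)) * q \<in> Q" using Q_prod[OF q q] inv Q_left_mult q by blast
    moreover have "inverse (- (q * q)) * q = - inverse q"
      using Q_nonzero[OF q]
      by (simp add: nonzero_inverse_minus_eq nonzero_inverse_mult_distrib mult.assoc)
    ultimately show ?thesis using Qneg by fastforce
  qed
  then show "inverse h \<in> H \<union> Q" if "h \<in> H \<union> Q" for h using that inv by blast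
  show "qnorm h = 1" if "h \<in> H \<union> Q" for h using that norm Q_norm by blast
qed

text \<open>As a coset other than \<open>H\<close>, \<open>Q\<close> is disjoint from
  \<open>H\<close>, so \<open>H \<union> Q\<close> has twice the order and its rotation group has
  order 24, 48 or 120. Outside the dihedral types only 24 occurs, for the octahedral group.\<close>

lemma extension_type:
  assumes T: "pole_type H N 3 r A B C" and 1: "1 \<notin> Q"
  obtains x where "r = 3" "x \<in> imag_units" "card (stab (H \<union> Q) x) = 8"
proof -
  interpret M: unit_group_neg "H \<union> Q" by (rule extension_group)
  have rN: "r = 3 \<and> N = 12 \<or> r = 4 \<and> N = 24 \<or> r = 5 \<and> N = 60"
    using pole_typeD(15)[OF T] by simp
  have cH: "card H = 2 * N" by (rule pole_typeD(1)[OF T])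
  have st: "card (stab H u) \<le> 10" if "u \<in> poles H" for u
    using that pole_typeD(2,9-11)[OF T] rN by auto
  obtain p where p: "p \<in> Q" using refl_ex by blast
  have "card Q = card H"
    unfolding Q_coset[OF p] using Q_nonzero[OF p] by (intro card_image inj_onI) auto
  moreover have "finite Q" using M.fin by simp
  moreover have "H \<inter> Q = {}" using 1 Q_eq_H_iff by blast
  ultimately have cM: "card (H \<union> Q) = 4 * N" using cH fin by (simp add: card_Un_disjoint)
  have "nonabelian (H \<union> Q)" using nonab unfolding nonabelian_def by blast
  then obtain N' q' r' A' B' C' where T': "pole_type (H \<union> Q) N' q' r' A' B' C'"
    by (rule M.pole_type_exists)
  note TD' = pole_typeD[OF T']
  have NN: "N' = 2 * N" using cM TD'(1) by simp
  obtain x where x: "x \<in> C'" "x \<in> imag_units"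
    using M.pole_type_N_pos(4,10)[OF T'] by (auto simp: poles_def)
  \<comment> \<open>A dihedral group of this order would give \<open>x\<close> an orbit of at most
    two elements, hence a stabilizer in \<open>H\<close> of order at least 12, whereas the type of
    \<open>H\<close> allows at most 10.\<close>
  have "q' = 3"
  proof (rule ccontr)
    assume "q' \<noteq> 3"
    then have r': "r' > 0" "N' = 2 * r'" using TD'(15) by auto
    then have "card C' = 2" using TD'(14) by simp
    moreover have "orb H x \<subseteq> orb (H \<union> Q) x" by (auto simp: orb_def)
    then have "orb H x \<subseteq> C'" using TD'(8)[OF x(1)] by simp
    ultimately have "card (orb H x) \<le> 2"
      using card_mono[OF M.pole_type_N_pos(7)[OF T']] by metis
    then have "card H \<le> 2 * card (stab H x)"
      by (metis orbit_stabilizer mult_le_mono1)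
    then have "card (stab H x) \<ge> 12" using cH rN by linarith
    moreover from this have "x \<in> poles H" using x pole_iff by simp
    ultimately show False using st by fastforce
  qed
  then have "r' = 4 \<and> r = 3" using TD'(15) rN NN by auto
  then show thesis using that x(2) TD'(11)[OF x(1)] by simp
qed

text \<open>The stabilizer of order 8 splits evenly between \<open>H\<close> and \<open>Q\<close>,
  so its part in \<open>H\<close> consists of \<open>1\<close>, \<open>- 1\<close>,
  \<open>x\<close>, \<open>- x\<close>. The square of an element \<open>w\<close> of the other half
  is one of these, and it is neither \<open>1\<close> nor \<open>- 1\<close>, since \<open>w\<close>
  would then lie in \<open>H\<close>.\<close>

lemma extension_sqrt:
  assumes T: "pole_type H N 3 3 A B C" and 1: "1 \<notin> Q"
    and x: "x \<in> imag_units" and c: "card (stab (H \<union> Q) x) = 8"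
  obtains w where "w \<in> Q" "w * w \<in> imag_units" "card (stab H (w * w)) = 4"
proof -
  have d: "H \<inter> Q = {}" using 1 Q_eq_H_iff by blast
  define D where "D = {q \<in> Q. q * x = x * q}"
  interpret M: unit_group_neg "H \<union> Q" by (rule extension_group)
  have finD: "finite D" using M.fin by (simp add: D_def)
  have "stab (H \<union> Q) x = stab H x \<union> D" by (auto simp: stab_def D_def)
  moreover have "stab H x \<inter> D = {}" using d by (auto simp: stab_def D_def)
  moreover have "finite (stab H x)" using fin by (simp add: stab_def)
  ultimately have sum: "card (stab H x) + card D = 8" using c finD by (simp add: card_Un_disjoint)
  have st: "card (stab H u) = 4 \<or> card (stab H u) = 6" if "u \<in> poles H" for u
    using that pole_typeD(2,9-11)[OF T] by auto
  have "D \<noteq> {}"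
  proof
    assume "D = {}"
    then have "card (stab H x) = 8" using sum by simp
    then show False using st[of x] x pole_iff by simp
  qed
  then obtain w where w: "w \<in> Q" "w * x = x * w" by (auto simp: D_def)
  note w0 = Q_nonzero[OF w(1)]
  have "card D \<le> card (stab H x)"
  proof (rule card_inj_on_le)
    show "inj_on ((*) (inverse w)) D" using w0 by (auto intro: inj_onI)
    show "(*) (inverse w) ` D \<subseteq> stab H x"
    proof
      fix k assume "k \<in> (*) (inverse w) ` D"
      then obtain v where v: "v \<in> Q" "v * x = x * v" "k = inverse w * v" by (auto simp: D_def)
      have "inverse w * x = x * inverse w"
        using w(2) w0 by (metis left_inverse mult.assoc mult_1 mult_1_right right_inverse)
      then have "k * x = x * k" using v by (metis mult.assoc)
      then show "k \<in> stab H x" using v w Q_inverse_mult by (simp add: stab_def)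
    qed
    show "finite (stab H x)" using fin by (simp add: stab_def)
  qed
  moreover have "card (stab H x) \<le> card D"
  proof (rule card_inj_on_le)
    show "inj_on ((*) w) (stab H x)" using w0 by (auto intro: inj_onI)
    show "(*) w ` stab H x \<subseteq> D"
      using w Q_mult by (auto simp: stab_def D_def) (metis mult.assoc)
    show "finite D" by (rule finD)
  qed
  ultimately have c4: "card (stab H x) = 4" using sum by simp
  note s = stab_4[OF x c4]
  have "- (w * w) \<in> H" by (rule Q_prod[OF w(1) w(1)])
  then have "w * w \<in> H" using uminus by fastforce
  moreover have "w * w * x = x * (w * w)" using w by (metis mult.assoc)
  ultimately have "w * w \<in> {1, - 1, x, - x}" using s(2) by (auto simp: stab_def)
  moreover have "w * w \<noteq> 1"
  proof
    assume "w * w = 1"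
    then have "w \<in> H" using one neg_one by (auto simp: square_eq_1_iff)
    then show False using d w by blast
  qed
  moreover have "w * w \<noteq> - 1"
  proof
    assume "w * w = - 1"
    then have "w = x \<or> w = - x"
      using imag_units_commute_eq[OF x, of w] w(2) by (auto simp: imag_units_def)
    then have "w \<in> H" using s(1) uminus by auto
    then show False using d w by blast
  qed
  ultimately have "w * w = x \<or> w * w = - x" by blast
  then show thesis using that[OF w(1)] x c4 stab_uminus by auto
qed

text \<open>If \<open>Q = H\<close>, the reflections \<open>i r\<close> have \<open>r\<close> in \<open>{a, -a, b, -b, c, -c}\<close>. Either \<open>a\<close>, \<open>b\<close>, \<open>c\<close> are
  orthogonal and generate a group of order 8, or they are coplanar and \<open>H\<close> fixes the normal.\<close>

lemma tetrahedral_proper: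
  assumes T: "pole_type H N 3 3 A B C"
  shows "1 \<notin> Q"
proof
  assume "1 \<in> Q"
  then have QH: "Q = H" using Q_coset[of 1] by simp
  note TD = pole_typeD[OF T] and P = pole_type_N_pos[OF T]
  have cA: "card A = 6" and cH: "card H = 24" using TD(1,12,15) by auto
  \<comment> \<open>Off \<open>A\<close>, a pole has a stabilizer of order 6. That group would
    contain the four elements \<open>1\<close>, \<open>- 1\<close>, \<open>u\<close>,
    \<open>- u\<close> and a disjoint translate of them, 8 in all.\<close>
  have pA: "u \<in> A" if u: "u \<in> H" "u \<in> imag_units" for u
  proof (rule ccontr)
    assume "u \<notin> A"
    interpret S: unit_group "stab H u" by (rule stab_unit_group)
    have u1: "u \<noteq> 1" "u \<noteq> - 1" using u one_neq by (auto simp: imag_units_def)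
    then have "u \<in> poles H" using u by (auto simp: poles_def)
    then have c: "card (stab H u) = 6" using TD(2,10,11) \<open>u \<notin> A\<close> by auto
    let ?V = "{1, - 1, u, - u}"
    have Vs: "?V \<subseteq> stab H u" using u one neg_one uminus by (auto simp: stab_def)
    have cV: "card ?V = 4"
      using u1 one_neq quat_uminus_neq[OF imag_units_nonzero[OF u(2)]]
      by (auto simp: card_insert_if minus_equation_iff)
    then have "\<not> stab H u \<subseteq> ?V" using card_mono[of ?V "stab H u"] c by auto
    then obtain h where h: "h \<in> stab H u" "h \<notin> ?V" by blast
    have h0: "h \<noteq> 0" using S.nonzero h by blast
    have VV: "v * inverse w \<in> ?V" if "v \<in> ?V" "w \<in> ?V" for v w
      using that u(2) imag_units_inverse[OF u(2)]
      by (auto simp: imag_units_sq nonzero_inverse_minus_eq imag_units_nonzero)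
    have "(\<lambda>v. v * h) ` ?V \<inter> ?V = {}"
    proof (rule ccontr)
      assume "\<not> ?thesis"
      then obtain v w where "v \<in> ?V" "w \<in> ?V" "v = w * h" by blast
      moreover from this have "h = inverse w * v"
        using imag_units_nonzero[OF u(2)] by (auto simp flip: mult.assoc)
      moreover have "inverse w * v = v * inverse w"
        using \<open>v \<in> ?V\<close> \<open>w \<in> ?V\<close> imag_units_inverse[OF u(2)]
        by (auto simp: nonzero_inverse_minus_eq imag_units_nonzero[OF u(2)])
      ultimately show False using VV h by metis
    qed
    moreover have "card ((\<lambda>v. v * h) ` ?V) = 4"
    proof -
      have "inj_on (\<lambda>v. v * h) ?V" using h0 mult_right_cancel by (intro inj_onI) blast
      then show ?thesis using cV card_image by metis
    qed
    moreover have "finite ((\<lambda>v. v * h) ` ?V)" "finite ?V" by blast+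
    ultimately have "card ((\<lambda>v. v * h) ` ?V \<union> ?V) = 8"
      using cV card_Un_disjoint[of "(\<lambda>v. v * h) ` ?V" ?V] by linarith
    moreover have "(\<lambda>v. v * h) ` ?V \<union> ?V \<subseteq> stab H u" using Vs S.mult h by blast
    then have "card ((\<lambda>v. v * h) ` ?V \<union> ?V) \<le> card (stab H u)" by (rule card_mono[OF S.fin])
    ultimately show False using c by linarith
  qed
  have Ai: "u \<in> imag_units" "u \<in> H" "- u \<in> A" if u: "u \<in> A" for u
  proof -
    show i: "u \<in> imag_units" using u P by (auto simp: poles_def)
    show "u \<in> H" using stab_4(1)[OF i TD(9)[OF u]] .
    then show "- u \<in> A" using i pA uminus by simp
  qed
  obtain a where a: "a \<in> A" using P by blast
  have n: "u \<noteq> - u" if "u \<in> A" for u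
    using quat_uminus_neq imag_units_nonzero Ai(1)[OF that] by metis
  have "\<not> A \<subseteq> {a, - a}" using card_mono[of "{a, - a}" A] cA n[OF a] by auto
  then obtain b where b: "b \<in> A" "b \<noteq> a" "b \<noteq> - a" by blast
  have "card {a, - a, b, - b} \<le> 4" using card_length[of "[a, - a, b, - b]"] by simp
  then have "\<not> A \<subseteq> {a, - a, b, - b}" using card_mono[of "{a, - a, b, - b}" A] cA by auto
  then obtain c where c: "c \<in> A" "c \<noteq> a" "c \<noteq> - a" "c \<noteq> b" "c \<noteq> - b" by blast
  have "card {a, - a, b, - b, c, - c} = 6"
    using n[OF a] n[OF b(1)] n[OF c(1)] b c
    by (auto simp: card_insert_if minus_equation_iff)
  then have A: "A = {a, - a, b, - b, c, - c}"
    using card_subset_eq[OF P(5), of "{a, - a, b, - b, c, - c}"] cA a b(1) c(1) Ai(3) by auto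
  have R: "Q \<inter> imag_units \<subseteq> {a, - a, b, - b, c, - c}" using pA QH A by blast
  note ai = Ai(1)[OF a] and bi = Ai(1)[OF b(1)]
  have ab: "a * b \<noteq> b * a" using imag_units_commute_eq[OF ai bi] b by blast
  have inva: "inverse a = - a" by (rule imag_units_inverse[OF ai])
  show False
  proof (cases "a * b = - (b * a)")
    case True
    have aa: "a * a = - 1" "b * b = - 1" using ai bi by (simp_all add: imag_units_sq)
    have aa': "a * (a * z) = - z" "b * (b * z) = - z" for z
      using aa by (simp_all flip: mult.assoc)
    have ba: "b * a = - (a * b)" using True by simp
    have ba': "b * (a * z) = - (a * (b * z))" for z
      using ba by (simp flip: mult.assoc)
    note rules = aa aa' ba ba' mult.assoc
    have "a * b \<in> imag_units" by (simp add: imag_units_def rules)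
    moreover have "a * b \<in> H" using mult Ai a b by blast
    ultimately have abA: "a * b \<in> A" by (rule pA[rotated])
    have "a * b \<noteq> a * 1" "a * b \<noteq> a * (- 1)" "a * b \<noteq> 1 * b" "a * b \<noteq> - 1 * b"
      using ai bi Ai one_neq imag_units_nonzero mult_left_cancel mult_right_cancel
      by (metis aa(1) aa(2) minus_minus mult.right_neutral mult_minus_left mult_minus_right)+
    then have "a * b = c \<or> a * b = - c" using abA A by auto
    then have R': "Q \<inter> imag_units \<subseteq> {a, - a, b, - b, a * b, - (a * b)}" using R by auto
    let ?V = "{1, - 1, a, - a, b, - b, a * b, - (a * b)}"
    have RV: "r * v \<in> ?V" if "r \<in> Q \<inter> imag_units" "v \<in> ?V" for r v
    proof -
      have "r \<in> {a, - a, b, - b, a * b, - (a * b)}" using that R' by blast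
      then show ?thesis using that(2)
        by (elim insertE emptyE) (simp_all add: rules)
    qed
    have "evens (Q \<inter> imag_units) \<subseteq> ?V"
    proof
      fix h assume "h \<in> evens (Q \<inter> imag_units)"
      then show "h \<in> ?V"
      proof induction
        case (step r s h)
        then have "r * (s * h) \<in> ?V" using RV by blast
        then have "- (r * (s * h)) \<in> ?V" by auto
        then show ?case by (simp add: mult.assoc)
      qed simp
    qed
    then have "H \<subseteq> ?V" using H_evens by blast
    moreover have "card ?V \<le> 8"
      using card_length[of "[1, - 1, a, - a, b, - b, a * b, - (a * b)]"] by simp
    moreover have "card H \<le> card ?V" by (rule card_mono) (use \<open>H \<subseteq> ?V\<close> in simp_all)
    ultimately show False using cH by linarith
  next
    \<comment> \<open>Conjugating \<open>b\<close> by \<open>a\<close> gives \<open>c\<close> up to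
      sign, so \<open>c\<close> lies in the plane of \<open>a\<close> and \<open>b\<close>. The
      normal \<open>z\<close> then anticommutes with \<open>r\<close> for every reflection
      \<open>\<i> r\<close> and commutes with all of \<open>H\<close>.\<close>
    case False
    have "a * b * inverse a \<in> orb H b" using Ai(2)[OF a] by (simp add: orb_def)
    then have f: "a * b * inverse a \<in> A" using TD(6)[OF b(1)] by blast
    have "a * b * inverse a \<noteq> a" "a * b * inverse a \<noteq> - a"
      using conj_eq_iff[OF imag_units_nonzero[OF ai], of b] b imag_units_nonzero[OF ai]
        mult_left_cancel[OF imag_units_nonzero[OF ai], of b a]
        mult_left_cancel[OF imag_units_nonzero[OF ai], of b "- a"] by auto
    moreover have "a * b * inverse a \<noteq> b" "a * b * inverse a \<noteq> - b"
      using conj_eq_iff[OF imag_units_nonzero[OF ai]] ab False by auto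
    ultimately have "a * b * inverse a = c \<or> a * b * inverse a = - c" using f A by auto
    then have c': "c = - (a * b * a) \<or> c = a * b * a" by (auto simp: inva)
    obtain z where z: "z \<in> imag_units" "z * a = - (a * z)" "z * b = - (b * z)"
      using orthogonal_imag_exists2[OF ai bi] .
    have zc: "z * (a * b * a) = - (a * b * a * z)"
      using z by (metis minus_mult_left minus_mult_right minus_minus mult.assoc)
    have "r * z = - (z * r)" if "r \<in> Q \<inter> imag_units" for r
      using that R c' z zc by auto
    then have "h * z = z * h" if "h \<in> H" for h
      using evens_commute H_evens that by blast
    then show False using nonabelian_no_axis[OF nonab z(1)] by blast
  qed
qed

lemma tetrahedral_sqrt:
  assumes T: "pole_type H N 3 3 A B C"
  obtains w where "w \<in> Q" "w * w \<in> imag_units" "card (stab H (w * w)) = 4"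
proof -
  have 1: "1 \<notin> Q" using T by (rule tetrahedral_proper)
  obtain x where "x \<in> imag_units" "card (stab (H \<union> Q) x) = 8"
    using T 1 by (rule extension_type)
  then show thesis by (rule extension_sqrt[OF T 1]) (rule that)
qed

end

text \<open>Cosets of \<open>H\<close> agree as soon as they meet. Each type supplies a common
  element: \<open>1\<close>, a pole on the main axis in the dihedral case, or in the tetrahedral
  case a square root of a pole in \<open>A\<close>, adjusted by conjugation in
  \<open>H\<close>.\<close>

theorem nonabelian_refl_pair_unique:
  assumes "refl_pair_nonabelian H Q" "refl_pair_nonabelian H Q'"
  shows "Q = Q'"
proof -
  interpret P: refl_pair_nonabelian H Q by fact
  interpret P': refl_pair_nonabelian H Q' by fact
  have "Q \<inter> Q' \<noteq> {}"
  proof -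
    obtain N q r A B C where T: "pole_type H N q r A B C" using P.nonab by (rule P.pole_type_exists)
    have qr: "q = 2 \<and> r \<ge> 2 \<or> q = 3" using pole_typeD(15)[OF T] by blast
    show ?thesis
    proof (cases "q = 2")
      case q: True
      show ?thesis
      proof (cases "r = 2")
        case True
        then show ?thesis using T q P.quaternion_axis P'.quaternion_axis by blast
      next
        case False
        then have "r \<ge> 3" using q qr by simp
        moreover obtain x where "x \<in> C" using P.pole_type_N_pos(4)[OF T] by blast
        ultimately show ?thesis using T q P.dihedral_axis P'.dihedral_axis by blast
      qed
    next
      case False
      then have q: "q = 3" using qr by simp
      show ?thesis
      proof (cases "r = 3")
        case True
        then have T: "pole_type H N 3 3 A B C" using T q by simp
        obtain w where w: "w \<in> Q" "w * w \<in> imag_units" "card (stab H (w * w)) = 4"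
          using T by (rule P.tetrahedral_sqrt)
        obtain v where v: "v \<in> Q'" "v * v \<in> imag_units" "card (stab H (v * v)) = 4"
          using T by (rule P'.tetrahedral_sqrt)
        have A: "u \<in> A" if "u \<in> imag_units" "card (stab H u) = 4" for u
        proof -
          have "u \<in> poles H" using that P.pole_iff by simp
          then show ?thesis using that pole_typeD(2,10,11)[OF T] by auto
        qed
        have "orb H (w * w) = A" using pole_typeD(6)[OF T A[OF w(2,3)]] .
        then obtain t where t: "t \<in> H" "v * v = t * (w * w) * inverse t"
          using A[OF v(2,3)] by (auto simp: orb_def)
        \<comment> \<open>Conjugating \<open>w\<close> within \<open>H\<close> makes its square
          equal to that of \<open>v\<close>. Commuting with \<open>v * v\<close>, the result
          \<open>u\<close> commutes with \<open>v\<close>, so that \<open>u * u - v * v\<close>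
          factors.\<close>
        define u where "u = t * w * inverse t"
        have u: "u \<in> Q" using t w P.Q_left_mult P.Q_mult P.inv by (simp add: u_def)
        have uv: "u * u = v * v" using conj_mult[OF P.nonzero[OF t(1)]] t by (simp add: u_def)
        have "u * (v * v) = v * v * u" unfolding uv[symmetric] by (simp add: mult.assoc)
        then have "u * v = v * u"
          using commute_imag_trans[OF v(2), of u v] by (simp add: mult.assoc)
        then have "(u - v) * (u + v) = 0" using uv by (simp add: algebra_simps)
        then have "u = v \<or> u = - v" by (simp add: eq_neg_iff_add_eq_0)
        moreover have "- v \<in> Q'" using P'.Q_mult[OF v(1) P.neg_one] by simp
        ultimately show ?thesis using u v by auto
      next
        case False
        then have "1 \<in> Q" "1 \<in> Q'"
          using T q P.extension_type P'.extension_type by blast+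
        then show ?thesis by blast
      qed
    qed
  qed
  then show ?thesis using P.Q_coset P'.Q_coset by blast
qed

text \<open>For abelian \<open>H\<close> the coset \<open>Q\<close> is only unique up to the rotations around the axis of \<open>H\<close>.\<close>

theorem refl_pair_unique:
  assumes "refl_pair H Q" "refl_pair H Q'"
  obtains g where "qnorm g = 1" "(\<lambda>h. g * h * inverse g) ` H = H" "(\<lambda>q. g * q * inverse g) ` Q = Q'"
proof (cases "nonabelian H")
  case True
  then have "Q = Q'"
    using assms nonabelian_refl_pair_unique
    by (simp add: refl_pair_nonabelian_def refl_pair_nonabelian_axioms_def)
  then show thesis by (intro that[of 1]) auto
next
  case False
  interpret P: refl_pair H Q by fact
  interpret P': refl_pair H Q' by fact
  \<comment> \<open>The aim is an axis \<open>x\<close> of \<open>H\<close> to which some reflection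
    of each family is orthogonal. The rotation about \<open>x\<close> that takes one of these
    reflections to the other then fixes \<open>H\<close> pointwise.\<close>
  have "\<exists>x\<in>imag_units. (\<forall>h\<in>H. h * x = x * h) \<and> (\<exists>r\<in>Q \<inter> imag_units. r * x = - (x * r))
    \<and> (\<exists>r\<in>Q' \<inter> imag_units. r * x = - (x * r))"
  proof (cases "H \<subseteq> {1, - 1}")
    case True
    obtain r s where rs: "r \<in> Q \<inter> imag_units" "s \<in> Q' \<inter> imag_units"
      using P.refl_ex P'.refl_ex by blast
    then obtain x where "x \<in> imag_units" "x * r = - (r * x)" "x * s = - (s * x)"
      using orthogonal_imag_exists2[of r s] by blast
    moreover from this have "r * x = - (x * r)" "s * x = - (x * s)" by simp_all
    moreover have "\<forall>h\<in>H. h * x = x * h" using True by auto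
    ultimately show ?thesis using rs by blast
  next
    case nt: False
    obtain x where x: "x \<in> imag_units" "\<And>h. h \<in> H \<Longrightarrow> h * x = x * h"
      using False by (rule P.abelian_axis) blast
    \<comment> \<open>Conjugation by an element of \<open>S\<close> preserves the axis of
      \<open>H\<close>. If no \<open>r\<close> reverses \<open>x\<close>, each one is
      \<open>x\<close> or \<open>- x\<close>, and even products reduce to \<open>1\<close> and
      \<open>- 1\<close>.\<close>
    have anti: "\<exists>r\<in>S \<inter> imag_units. r * x = - (x * r)" if S: "refl_pair H S" for S
    proof (rule ccontr)
      assume n: "\<not> ?thesis"
      interpret S: refl_pair H S by fact
      obtain k where k: "k \<in> H" "k \<noteq> 1" "k \<noteq> - 1" using nt by blast
      have "S \<inter> imag_units \<subseteq> {x, - x}"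
      proof
        fix r assume r: "r \<in> S \<inter> imag_units"
        then have r0: "r \<noteq> 0" using imag_units_nonzero by blast
        define y where "y = inverse r * x * inverse (inverse r)"
        have y: "y \<in> imag_units"
          unfolding y_def using x(1) r0 conj_imag_units nonzero_imp_inverse_nonzero by blast
        have ry: "r * y = x * r" using r0 by (simp add: y_def flip: mult.assoc)
        have "r * k * inverse r \<in> H" using r k S.Q_conj by blast
        then have "r * k * inverse r * x = x * (r * k * inverse r)" by (rule x(2))
        then have "k * y = y * k"
          using r0 by (simp add: y_def mult.assoc)
            (metis left_inverse mult.assoc mult_1 mult_1_right right_inverse)
        then have "y * x = x * y" using axis_commute[OF P.norm[OF k(1)] k(2,3) x(1) x(2)[OF k(1)]] by blast
        then have "y = x \<or> y = - x" using imag_units_commute_eq[OF x(1) y] by simp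
        then have "r * x = x * r \<or> r * x = - (x * r)" using ry by (metis minus_minus mult_minus_right)
        then have "r * x = x * r" using n r by blast
        then show "r \<in> {x, - x}" using imag_units_commute_eq[OF x(1)] r by auto
      qed
      have "h \<in> {1, - 1}" if "h \<in> evens (S \<inter> imag_units)" for h
        using that
      proof induction
        case (step r s a)
        then have "r \<in> {x, - x}" "s \<in> {x, - x}" using \<open>S \<inter> imag_units \<subseteq> {x, - x}\<close> by blast+
        then have "r * s \<in> {1, - 1}" using x(1) by (auto simp: imag_units_sq)
        then show ?case using step by auto
      qed simp
      then show False using nt S.H_evens by blast
    qed
    show ?thesis using x anti assms by blast
  qed
  then obtain x r s where x: "x \<in> imag_units" "\<And>h. h \<in> H \<Longrightarrow> h * x = x * h"
    and r: "r \<in> Q" "r \<in> imag_units" "r * x = - (x * r)"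
    and s: "s \<in> Q'" "s \<in> imag_units" "s * x = - (x * s)"
    by blast
  obtain g where g: "qnorm g = 1" "g * r = s * g" "g * x = x * g"
    using imag_units_conjugate[OF r(2) s(2) x(1) r(3) s(3)] .
  have gh: "g * h = h * g" if "h \<in> H" for h
    using commute_imag_trans[OF x(1) g(3) x(2)[OF that]] .
  have g0: "g \<noteq> 0" using g(1) qnorm_1_nonzero by blast
  have "(\<lambda>h. g * h * inverse g) ` H = (\<lambda>h. h) ` H"
    by (rule image_cong[OF refl]) (use gh conj_eq_iff[OF g0] in blast)
  moreover have "(\<lambda>q. g * q * inverse g) ` Q = Q'"
  proof -
    have "(\<lambda>q. g * q * inverse g) ` Q = (\<lambda>h. g * (r * h) * inverse g) ` H"
      by (subst P.Q_coset[OF r(1)]) (simp add: image_image)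
    also have "\<dots> = (\<lambda>h. s * h) ` H"
    proof (rule image_cong)
      fix h assume "h \<in> H"
      then have "g * (r * h) = s * h * g" using g(2) gh by (metis mult.assoc)
      then show "g * (r * h) * inverse g = s * h" using conj_eq_iff[OF g0] by blast
    qed simp
    also have "\<dots> = Q'" using P'.Q_coset[OF s(1)] by simp
    finally show ?thesis .
  qed
  ultimately show thesis using that g(1) by simp
qed

section \<open>Matrices\<close>

definition qmat :: "quat \<Rightarrow> complex^2^2" where
  "qmat q = vector [vector [Complex (qre q) (qi q), Complex (qj q) (qk q)],
    vector [Complex (- qj q) (qk q), Complex (qre q) (- qi q)]]"

text \<open>The scalar matrix \<open>mat \<i>\<close> has determinant -1, so multiplying by it
  exchanges determinants 1 and -1; for unit \<open>q\<close> these are the remaining elements of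
  \<open>U2pm\<close>.\<close>

definition iqmat :: "quat \<Rightarrow> complex^2^2" where
  "iqmat q = mat \<i> ** qmat q"

lemma qmat_nth [simp]:
  "qmat q $ 1 $ 1 = Complex (qre q) (qi q)" "qmat q $ 1 $ 2 = Complex (qj q) (qk q)"
  "qmat q $ 2 $ 1 = Complex (- qj q) (qk q)" "qmat q $ 2 $ 2 = Complex (qre q) (- qi q)"
  by (simp_all add: qmat_def)

lemma mat_nth_2 [simp]:
  "(mat c :: 'a::zero^2^2) $ 1 $ 1 = c" "(mat c :: 'a::zero^2^2) $ 1 $ 2 = 0"
  "(mat c :: 'a::zero^2^2) $ 2 $ 1 = 0" "(mat c :: 'a::zero^2^2) $ 2 $ 2 = c"
  by (simp_all add: mat_def)

lemma matrix_mult_2: "(A ** B) $ i $ j = A $ i $ 1 * B $ 1 $ j + A $ i $ 2 * B $ 2 $ j"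
  for A B :: "'a::semiring_1^2^2"
  by (simp add: matrix_matrix_mult_def sum_2)

lemma matrix_eq_2: "A = B \<longleftrightarrow>
    A $ 1 $ 1 = B $ 1 $ 1 \<and> A $ 1 $ 2 = B $ 1 $ 2 \<and> A $ 2 $ 1 = B $ 2 $ 1 \<and> A $ 2 $ 2 = B $ 2 $ 2"
  for A B :: "'a^2^2"
  by (auto simp: vec_eq_iff forall_2)

lemma iqmat_nth [simp]:
  "iqmat q $ 1 $ 1 = Complex (- qi q) (qre q)" "iqmat q $ 1 $ 2 = Complex (- qk q) (qj q)"
  "iqmat q $ 2 $ 1 = Complex (- qk q) (- qj q)" "iqmat q $ 2 $ 2 = Complex (qi q) (qre q)"
  by (simp_all add: iqmat_def matrix_mult_2 complex_eq_iff)

lemma qmat_mult: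
  "qmat p ** qmat q = qmat (p * q)" "iqmat p ** qmat q = iqmat (p * q)"
  "qmat p ** iqmat q = iqmat (p * q)" "iqmat p ** iqmat q = qmat (- (p * q))"
  by (simp_all add: matrix_eq_2 matrix_mult_2 complex_eq_iff algebra_simps)

lemma qmat_1: "qmat 1 = mat 1"
  by (simp add: matrix_eq_2 complex_eq_iff)

lemma qmat_inject: "qmat p = qmat q \<longleftrightarrow> p = q" and iqmat_inject: "iqmat p = iqmat q \<longleftrightarrow> p = q"
  by (auto simp: matrix_eq_2 complex_eq_iff quat_eq_iff)

lemma det_qmat: "det (qmat q) = of_real (qnorm q)" and det_iqmat: "det (iqmat q) = - of_real (qnorm q)"
  by (simp_all add: det_2 complex_eq_iff qnorm_def algebra_simps)

lemma conj_transpose_qmat: "conj_transpose (qmat q) = qmat (qcnj q)"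
  and conj_transpose_iqmat: "conj_transpose (iqmat q) = iqmat (- qcnj q)"
  by (simp_all add: matrix_eq_2 conj_transpose_def complex_eq_iff qcnj_def)

lemma qcnj_right: "q * qcnj q = 1" if "qnorm q = 1"
  using inverse_unit[OF that] right_inverse[OF qnorm_1_nonzero[OF that]] by simp

lemma special_unitary_qmat:
  assumes "A ** conj_transpose A = mat 1" "det A = 1"
  obtains q where "qnorm q = 1" "A = qmat q"
proof -
  \<comment> \<open>The adjugate of \<open>A\<close>. With determinant 1 it is the inverse, so
    unitarity equates it with the conjugate transpose.\<close>
  define B :: "complex^2^2" where
    "B = vector [vector [A $ 2 $ 2, - A $ 1 $ 2], vector [- A $ 2 $ 1, A $ 1 $ 1]]"
  have "B ** A = mat 1"
    using assms(2) by (simp add: matrix_eq_2 matrix_mult_2 B_def det_2 algebra_simps)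
  then have "conj_transpose A = B"
    using assms(1) by (metis matrix_mul_assoc matrix_mul_lid matrix_mul_rid)
  then have e: "cnj (A $ 1 $ 1) = A $ 2 $ 2" "cnj (A $ 2 $ 1) = - A $ 1 $ 2"
    by (simp_all add: matrix_eq_2 conj_transpose_def B_def)
  define q where "q = Quat (Re (A $ 1 $ 1)) (Im (A $ 1 $ 1)) (Re (A $ 1 $ 2)) (Im (A $ 1 $ 2))"
  have A: "A = qmat q"
    using e by (simp add: matrix_eq_2 q_def complex_eq_iff)
  then have "qnorm q = 1"
    using assms(2) by (simp add: det_qmat)
  then show thesis using A by (rule that)
qed

section \<open>Unitary matrices and reflections as unit quaternions\<close>

lemma carrier_SU2: "carrier SU2 = qmat ` {q. qnorm q = 1}"
proof
  show "carrier SU2 \<subseteq> qmat ` {q. qnorm q = 1}"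
    using special_unitary_qmat by (fastforce simp: SU2_def U2pm_def)
  show "qmat ` {q. qnorm q = 1} \<subseteq> carrier SU2"
    by (auto simp: SU2_def U2pm_def det_qmat conj_transpose_qmat qmat_mult qcnj_right qmat_1)
qed

lemma carrier_U2pm: "carrier U2pm = qmat ` {q. qnorm q = 1} \<union> iqmat ` {q. qnorm q = 1}"
proof
  show "carrier U2pm \<subseteq> qmat ` {q. qnorm q = 1} \<union> iqmat ` {q. qnorm q = 1}"
  proof
    fix A assume "A \<in> carrier U2pm"
    then have A: "A ** conj_transpose A = mat 1" "det A = 1 \<or> det A = - 1"
      by (auto simp: U2pm_def)
    show "A \<in> qmat ` {q. qnorm q = 1} \<union> iqmat ` {q. qnorm q = 1}"
    proof (cases "det A = 1")
      case True
      then show ?thesis using special_unitary_qmat[OF A(1)] by blast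
    next
      case False
      define B where "B = mat (- \<i>) ** A"
      have "conj_transpose (mat (- \<i>) :: complex^2^2) = mat \<i>"
        by (simp add: matrix_eq_2 conj_transpose_def)
      then have "B ** conj_transpose B = mat (- \<i>) ** (A ** conj_transpose A) ** mat \<i>"
        unfolding B_def conj_transpose_mult
        by (simp add: matrix_mul_assoc)
      also have "\<dots> = mat 1" unfolding A(1) by (simp add: matrix_eq_2 matrix_mult_2)
      finally have "B ** conj_transpose B = mat 1" .
      moreover have "det B = 1"
        using A(2) False by (simp add: B_def det_mul) (simp add: det_2)
      ultimately obtain q where q: "qnorm q = 1" "B = qmat q" by (rule special_unitary_qmat)
      have "A = mat \<i> ** B" by (simp add: B_def matrix_eq_2 matrix_mult_2)
      then have "A = iqmat q" by (simp add: iqmat_def q)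
      then show ?thesis using q by blast
    qed
  qed
  show "qmat ` {q. qnorm q = 1} \<union> iqmat ` {q. qnorm q = 1} \<subseteq> carrier U2pm"
    by (auto simp: U2pm_def det_qmat det_iqmat conj_transpose_qmat conj_transpose_iqmat qmat_mult
        qcnj_right qmat_1)
qed

lemma iqmat_not_SU2: "qnorm q = 1 \<Longrightarrow> iqmat q \<notin> carrier SU2"
  by (simp add: SU2_def det_iqmat)

text \<open>The matrix is the identity minus the rank-one matrix with entries
  \<open>2 * l j * a $ i\<close>. So its trace is \<open>2 - 2 * lam a\<close> and its determinant
  \<open>1 - 2 * lam a\<close>.\<close>

lemma is_reflection_trace_det:
  assumes "is_reflection A"
  shows "A $ 1 $ 1 + A $ 2 $ 2 = 0" "det A = - 1"
proof -
  obtain lam a where lam: "Vector_Spaces.linear (*s) (*) lam" "lam a = 1"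
    and A: "\<And>v. A *v v = v - (2 * lam v) *s a"
    using assms by (auto simp: is_reflection_def)
  define l where "l j = lam (axis j 1)" for j
  have Aij: "A $ i $ j = (if i = j then 1 else 0) - 2 * l j * a $ i" for i j
  proof -
    have "A $ i $ j = (A *v axis j 1) $ i"
      using exhaust_2[of j] by (auto simp: matrix_vector_mult_def sum_2 axis_def)
    then show ?thesis unfolding A by (simp add: l_def axis_def)
  qed
  have "a = a $ 1 *s axis 1 1 + a $ 2 *s axis 2 1"
    by (simp add: vec_eq_iff forall_2 axis_def)
  then have "lam a = lam (a $ 1 *s axis 1 1 + a $ 2 *s axis 2 1)" by simp
  also have "\<dots> = a $ 1 * l 1 + a $ 2 * l 2"
    unfolding l_def using lam(1)
    by (simp add: Vector_Spaces.linear_iff)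
  finally have l: "a $ 1 * l 1 + a $ 2 * l 2 = 1" using lam(2) by simp
  have "A $ 1 $ 1 + A $ 2 $ 2 = 2 - 2 * (a $ 1 * l 1 + a $ 2 * l 2)"
    "det A = 1 - 2 * (a $ 1 * l 1 + a $ 2 * l 2)"
    unfolding det_2 Aij by (simp_all add: algebra_simps)
  then show "A $ 1 $ 1 + A $ 2 $ 2 = 0" "det A = - 1" using l by simp_all
qed

text \<open>The matrix \<open>mat 1 - A\<close> has trace 2 and determinant 0, hence rank one, and
  factors as a column times a row.\<close>

lemma is_reflectionI:
  assumes "A $ 1 $ 1 + A $ 2 $ 2 = 0" "det A = - 1"
  shows "is_reflection A"
proof -
  have t: "A $ 2 $ 2 = - A $ 1 $ 1" using assms(1) by (simp add: add_eq_0_iff)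
  then have d: "A $ 1 $ 2 * A $ 2 $ 1 = (1 - A $ 1 $ 1) * (1 + A $ 1 $ 1)"
    using assms(2) by (simp add: det_2 algebra_simps)
  \<comment> \<open>The witness \<open>(a1, a2)\<close> is a nonzero column of
    \<open>mat 1 - A\<close>: the second if the first diagonal entry of \<open>mat 1 - A\<close>
    vanishes, the first otherwise.\<close>
  have "\<exists>l1 l2 a1 a2. l1 * a1 + l2 * a2 = 1 \<and> A $ 1 $ 1 = 1 - 2 * l1 * a1 \<and>
    A $ 1 $ 2 = - (2 * l2 * a1) \<and> A $ 2 $ 1 = - (2 * l1 * a2) \<and> A $ 2 $ 2 = 1 - 2 * l2 * a2"
  proof (cases "A $ 1 $ 1 = 1")
    case True
    then show ?thesis using t d
      by (intro exI[of _ "- A $ 2 $ 1 / 4"] exI[of _ "1 / 2"] exI[of _ "- A $ 1 $ 2"] exI[of _ 2]) auto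
  next
    case False
    define w where "w = 1 - A $ 1 $ 1"
    have "w \<noteq> 0" "A $ 1 $ 2 * A $ 2 $ 1 = w * (2 - w)" "A $ 1 $ 1 = 1 - w" "A $ 2 $ 2 = w - 1"
      using False d t by (simp_all add: w_def)
    then have w: "w \<noteq> 0" "A $ 1 $ 1 = 1 - w" "A $ 2 $ 2 = w - 1"
      and p: "A $ 1 $ 2 * A $ 2 $ 1 / w = 2 - w" by simp_all
    show ?thesis
    proof (intro exI conjI)
      show "1 / 2 * w + - (A $ 1 $ 2 / w / 2) * - (A $ 2 $ 1) = 1"
        using p by (simp add: field_simps)
      show "A $ 1 $ 1 = 1 - 2 * (1 / 2) * w" "A $ 1 $ 2 = - (2 * - (A $ 1 $ 2 / w / 2) * w)"
        "A $ 2 $ 1 = - (2 * (1 / 2) * - (A $ 2 $ 1))"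
        using w by simp_all
      show "A $ 2 $ 2 = 1 - 2 * - (A $ 1 $ 2 / w / 2) * - (A $ 2 $ 1)"
        using w p by simp
    qed
  qed
  then obtain l1 l2 a1 a2 where l: "l1 * a1 + l2 * a2 = 1" "A $ 1 $ 1 = 1 - 2 * l1 * a1"
    "A $ 1 $ 2 = - (2 * l2 * a1)" "A $ 2 $ 1 = - (2 * l1 * a2)" "A $ 2 $ 2 = 1 - 2 * l2 * a2" by blast
  define a :: "complex^2" where "a = vector [a1, a2]"
  define lam where "lam v = l1 * v $ 1 + l2 * v $ 2" for v :: "complex^2"
  have "Vector_Spaces.linear (*s) (*) lam"
    by unfold_locales (simp_all add: lam_def algebra_simps)
  moreover have "lam a = 1" using l(1) by (simp add: lam_def a_def)
  moreover have "A *v v = v - (2 * lam v) *s a" for v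
    by (simp add: vec_eq_iff forall_2 matrix_vector_mult_def sum_2 a_def lam_def l(2-5) algebra_simps)
  ultimately show ?thesis unfolding is_reflection_def by blast
qed

lemma is_reflection_iqmat:
  assumes "qnorm q = 1"
  shows "is_reflection (iqmat q) \<longleftrightarrow> q \<in> imag_units"
proof
  assume "is_reflection (iqmat q)"
  then have "qre q = 0" using is_reflection_trace_det(1)[of "iqmat q"] by (simp add: complex_eq_iff)
  then show "q \<in> imag_units" using assms by (simp add: imag_units_iff)
next
  assume "q \<in> imag_units"
  then show "is_reflection (iqmat q)"
    using assms by (intro is_reflectionI) (simp_all add: complex_eq_iff imag_units_iff det_iqmat)
qed

lemma U2pm_reflection:
  assumes "A \<in> carrier U2pm" "is_reflection A"
  obtains r where "r \<in> imag_units" "A = iqmat r"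
proof -
  have "det A = - 1" using assms(2) by (rule is_reflection_trace_det)
  then obtain q where "qnorm q = 1" "A = iqmat q"
    using assms(1) by (auto simp: carrier_U2pm det_qmat)
  then show thesis using that assms(2) is_reflection_iqmat by blast
qed

section \<open>Conjugation in terms of quaternions\<close>

lemma mult_U2pm [simp]: "A \<otimes>\<^bsub>U2pm\<^esub> B = A ** B" "A \<otimes>\<^bsub>SU2\<^esub> B = A ** B" "A \<otimes>\<^bsub>GL2\<^esub> B = A ** B"
  and one_U2pm [simp]: "\<one>\<^bsub>U2pm\<^esub> = mat 1" "\<one>\<^bsub>SU2\<^esub> = mat 1" "\<one>\<^bsub>GL2\<^esub> = mat 1"
  by (simp_all add: SU2_def U2pm_def GL2_def)

lemma qmat_carrier: "qnorm q = 1 \<Longrightarrow> qmat q \<in> carrier SU2"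
    "qnorm q = 1 \<Longrightarrow> qmat q \<in> carrier U2pm" "qnorm q = 1 \<Longrightarrow> iqmat q \<in> carrier U2pm"
  by (auto simp: carrier_SU2 carrier_U2pm)

lemma inv_qmat:
  assumes "qnorm q = 1"
  shows "inv\<^bsub>U2pm\<^esub> (qmat q) = qmat (inverse q)" "inv\<^bsub>SU2\<^esub> (qmat q) = qmat (inverse q)"
    "inv\<^bsub>U2pm\<^esub> (iqmat q) = iqmat (- inverse q)"
proof -
  note n = assms qnorm_inverse[OF assms] qnorm_1_nonzero[OF assms]
  show "inv\<^bsub>U2pm\<^esub> (qmat q) = qmat (inverse q)"
    by (rule group.inv_equality[OF group_U2pm]) (use n in \<open>simp_all add: qmat_carrier qmat_mult qmat_1\<close>)
  show "inv\<^bsub>SU2\<^esub> (qmat q) = qmat (inverse q)"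
    by (rule group.inv_equality[OF group_SU2]) (use n in \<open>simp_all add: qmat_carrier qmat_mult qmat_1\<close>)
  show "inv\<^bsub>U2pm\<^esub> (iqmat q) = iqmat (- inverse q)"
    by (rule group.inv_equality[OF group_U2pm]) (use n in \<open>simp_all add: qmat_carrier qmat_mult qmat_1\<close>)
qed

definition cjset :: "quat \<Rightarrow> quat set \<Rightarrow> quat set" where
  "cjset k S = (\<lambda>h. k * h * inverse k) ` S"

lemma cjset_cjset:
  assumes "qnorm k = 1" "qnorm l = 1"
  shows "cjset k (cjset l S) = cjset (k * l) S"
  using qnorm_1_nonzero[OF assms(1)] qnorm_1_nonzero[OF assms(2)]
  by (simp add: cjset_def image_image nonzero_inverse_mult_distrib mult.assoc)

lemma cjset_norm:
  assumes "\<And>q. q \<in> S \<Longrightarrow> qnorm q = 1" "qnorm k = 1" "p \<in> cjset k S"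
  shows "qnorm p = 1"
proof -
  obtain q where "q \<in> S" "p = k * q * inverse k" using assms(3) by (auto simp: cjset_def)
  then show ?thesis using assms(1,2) qnorm_inverse[OF assms(2)] by (simp add: qnorm_mult)
qed

lemma cjset_1: "cjset 1 S = S"
  by (simp add: cjset_def)

lemma cjset_inverse: "qnorm k = 1 \<Longrightarrow> cjset (inverse k) (cjset k S) = S"
  by (simp add: cjset_cjset qnorm_inverse cjset_1 qnorm_1_nonzero)

definition pmset :: "quat set \<Rightarrow> quat set \<Rightarrow> (complex^2^2) set" where
  "pmset H Q = qmat ` H \<union> iqmat ` Q"

lemma pmset_SU2:
  assumes "\<And>h. h \<in> H \<Longrightarrow> qnorm h = 1" "\<And>q. q \<in> Q \<Longrightarrow> qnorm q = 1"
  shows "pmset H Q \<inter> carrier SU2 = qmat ` H"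
  using assms qmat_carrier(1) iqmat_not_SU2 by (auto simp: pmset_def)

lemma conjugate_image: "(g <#\<^bsub>K\<^esub> S) #>\<^bsub>K\<^esub> h = (\<lambda>s. g \<otimes>\<^bsub>K\<^esub> s \<otimes>\<^bsub>K\<^esub> h) ` S"
  by (auto simp: l_coset_def r_coset_def)

lemma conj_class_SU2: "conj_class SU2 (qmat ` H) = {qmat ` cjset k H | k. qnorm k = 1}"
proof -
  have "(qmat k <#\<^bsub>SU2\<^esub> (qmat ` H)) #>\<^bsub>SU2\<^esub> inv\<^bsub>SU2\<^esub> (qmat k) = qmat ` cjset k H"
    if "qnorm k = 1" for k
    unfolding conjugate_image
    by (simp add: inv_qmat[OF that] cjset_def image_image qmat_mult)
  then show ?thesis unfolding conj_class_def carrier_SU2 by blast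
qed

text \<open>The central matrix \<open>iI\<close> acts trivially by conjugation, so conjugation by elements of
  determinant \<open>-1\<close> yields nothing new.\<close>

lemma conj_class_U2pm: "conj_class U2pm (pmset H Q) = {pmset (cjset k H) (cjset k Q) | k. qnorm k = 1}"
proof -
  have "(qmat k <#\<^bsub>U2pm\<^esub> (pmset H Q)) #>\<^bsub>U2pm\<^esub> inv\<^bsub>U2pm\<^esub> (qmat k) = pmset (cjset k H) (cjset k Q)"
    "(iqmat k <#\<^bsub>U2pm\<^esub> (pmset H Q)) #>\<^bsub>U2pm\<^esub> inv\<^bsub>U2pm\<^esub> (iqmat k) = pmset (cjset k H) (cjset k Q)"
    if "qnorm k = 1" for k
    unfolding conjugate_image
    by (simp_all add: inv_qmat[OF that] cjset_def image_image qmat_mult pmset_def image_Un)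
  then show ?thesis unfolding conj_class_def carrier_U2pm by blast
qed

lemma refl_pair_cjset:
  assumes k: "qnorm k = 1" and "refl_pair H Q"
  shows "refl_pair (cjset k H) (cjset k Q)"
proof -
  interpret refl_pair H Q by fact
  have k0: "k \<noteq> 0" using k qnorm_1_nonzero by blast
  let ?c = "\<lambda>h. k * h * inverse k"
  have c: "?c (g * h) = ?c g * ?c h" for g h using conj_mult[OF k0] by simp
  have ci: "?c (inverse h) = inverse (?c h)" if "h \<noteq> 0" for h
    using that k0 by (simp add: nonzero_inverse_mult_distrib mult.assoc)
  have cn: "qnorm (?c h) = qnorm h" for h
    using k qnorm_inverse[OF k] by (simp add: qnorm_mult)
  have c1: "?c 1 = 1" using k0 by simp
  have ev: "?c a \<in> evens (cjset k Q \<inter> imag_units)" if "a \<in> evens (Q \<inter> imag_units)" for a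
    using that
  proof induction
    case one
    show ?case unfolding c1 by (rule evens.one)
  next
    case (step r s a)
    have "?c (- (r * s * a)) = - (?c r * ?c s * ?c a)" by (simp add: c)
    moreover have "?c r \<in> cjset k Q \<inter> imag_units" "?c s \<in> cjset k Q \<inter> imag_units"
      using step conj_imag_units[OF k0] by (auto simp: cjset_def)
    ultimately show ?case using step evens.step by metis
  qed
  show ?thesis
  proof
    show "finite (cjset k H)" using fin by (simp add: cjset_def)
    show "1 \<in> cjset k H" unfolding cjset_def using one c1 by (metis image_eqI)
    show "g * h \<in> cjset k H" if "g \<in> cjset k H" "h \<in> cjset k H" for g h
      using that mult unfolding cjset_def by (auto simp flip: c)
    show "inverse h \<in> cjset k H" if "h \<in> cjset k H" for h
      using that inv nonzero unfolding cjset_def by (auto simp flip: ci)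
    show "qnorm h = 1" if "h \<in> cjset k H" for h
      using that norm cn by (auto simp: cjset_def)
    show "qnorm h = 1" if "h \<in> cjset k Q" for h
      using that Q_norm cn by (auto simp: cjset_def)
    show "q * h \<in> cjset k Q" if "q \<in> cjset k Q" "h \<in> cjset k H" for q h
      using that Q_mult unfolding cjset_def by (auto simp flip: c)
    show "- (p * q) \<in> cjset k H" if pq: "p \<in> cjset k Q" "q \<in> cjset k Q" for p q
    proof -
      obtain p' q' where p': "p' \<in> Q" "p = ?c p'" "q' \<in> Q" "q = ?c q'"
        using pq by (auto simp: cjset_def)
      then have "- (p * q) = ?c (- (p' * q'))" by (simp add: c)
      then show ?thesis using Q_prod p' unfolding cjset_def by blast
    qed
    show "cjset k Q \<inter> imag_units \<noteq> {}"
      using refl_ex conj_imag_units[OF k0] by (fastforce simp: cjset_def)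
    show "cjset k H \<subseteq> evens (cjset k Q \<inter> imag_units)"
      using ev H_evens by (auto simp: cjset_def)
  qed
qed

section \<open>Groups of matrices and their quaternions\<close>

lemma subgroup_SU2_unit_group:
  assumes "subgroup K SU2" "finite K"
  obtains H where "unit_group H" "K = qmat ` H"
proof -
  interpret subgroup K SU2 by fact
  let ?H = "{q. qnorm q = 1 \<and> qmat q \<in> K}"
  have "unit_group ?H"
  proof
    have "inj qmat" using qmat_inject by (auto intro: injI)
    then have "finite (qmat -` K)" by (rule finite_vimageI[OF assms(2)])
    then show "finite ?H" by (rule finite_subset[rotated]) auto
    show "1 \<in> ?H" using one_closed by (simp add: qmat_1)
    show "g * h \<in> ?H" if "g \<in> ?H" "h \<in> ?H" for g h
      using that m_closed by (auto simp: qnorm_mult simp flip: qmat_mult)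
    show "inverse h \<in> ?H" if "h \<in> ?H" for h
      using that m_inv_closed qnorm_inverse inv_qmat(2) by fastforce
  qed simp
  moreover have "K = qmat ` ?H" using subset by (auto simp: carrier_SU2)
  ultimately show thesis by (rule that)
qed

text \<open>Words of even length in the reflections give \<open>qmat\<close> of elements of
  \<open>evens R\<close>, words of odd length give \<open>iqmat\<close> of elements of
  \<open>odds\<close>. The sign of the determinant tells the two apart, so every element of
  determinant 1 in \<open>G\<close> comes from \<open>evens R\<close>.\<close>

lemma reflection_group_refl_pair:
  assumes "subgroup G U2pm" "finite_reflection_group G"
  obtains H Q where "refl_pair H Q" "G = pmset H Q"
proof -
  interpret subgroup G U2pm by fact
  obtain S where S: "S \<noteq> {}" "\<And>A. A \<in> S \<Longrightarrow> is_reflection A" "G = generate GL2 S" and fin: "finite G"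
    using assms(2) by (auto simp: finite_reflection_group_def)
  let ?H = "{q. qnorm q = 1 \<and> qmat q \<in> G}" and ?Q = "{q. qnorm q = 1 \<and> iqmat q \<in> G}"
  define R where "R = ?Q \<inter> imag_units"
  have SG: "S \<subseteq> G" unfolding S(3) by (auto intro: generate.incl)
  have SR: "\<exists>r\<in>R. A = iqmat r" if A: "A \<in> S" for A
  proof -
    have "A \<in> carrier U2pm" using A SG subset by blast
    then obtain r where "r \<in> imag_units" "A = iqmat r" using S(2)[OF A] by (rule U2pm_reflection)
    then show ?thesis using A SG imag_units_norm unfolding R_def by blast
  qed
  define odds where "odds = {r * e | r e. r \<in> R \<and> e \<in> evens R}"
  define M where "M = qmat ` evens R \<union> iqmat ` odds"
  have refl: "A ** B \<in> M" if A: "A \<in> S" and B: "B \<in> M" for A B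
  proof -
    obtain r where r: "r \<in> R" "A = iqmat r" using SR[OF A] by (elim bexE)
    from B consider e where "e \<in> evens R" "B = qmat e"
      | s e where "s \<in> R" "e \<in> evens R" "B = iqmat (s * e)"
      unfolding M_def odds_def by blast
    then show ?thesis
    proof cases
      case 1
      then have "A ** B = iqmat (r * e)" using r by (simp add: qmat_mult)
      moreover have "r * e \<in> odds" using 1(1) r(1) unfolding odds_def by blast
      ultimately show ?thesis by (simp add: M_def)
    next
      case 2
      then have "A ** B = qmat (- (r * s * e))" using r by (simp add: qmat_mult mult.assoc)
      moreover have "- (r * s * e) \<in> evens R" using r(1) 2(1,2) by (rule evens.step)
      ultimately show ?thesis by (simp add: M_def)
    qed
  qed
  have inv_refl: "inv\<^bsub>GL2\<^esub> A = A" if A: "A \<in> S" for A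
  proof (rule group.inv_equality[OF group_GL2])
    obtain r where r: "r \<in> imag_units" "A = iqmat r" using SR[OF A] unfolding R_def by blast
    show "A \<otimes>\<^bsub>GL2\<^esub> A = \<one>\<^bsub>GL2\<^esub>" by (simp add: r qmat_mult imag_units_sq qmat_1)
    have "A \<in> carrier U2pm" using A SG subset by blast
    then show "A \<in> carrier GL2" "A \<in> carrier GL2"
      using subgroup.subset[OF subgroup_U2pm_GL2] by blast+
  qed
  \<comment> \<open>Stating that left multiplication by \<open>A\<close> preserves \<open>M\<close>,
    rather than that \<open>A\<close> lies in \<open>M\<close>, makes the product case
    immediate.\<close>
  have gen: "\<forall>B\<in>M. A ** B \<in> M" if "A \<in> generate GL2 S" for A
    using that
  proof induction
    case one
    show ?case by (simp add: matrix_mul_lid)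
  next
    case (incl A)
    then show ?case using refl[of A] by (intro ballI)
  next
    case (inv A)
    then show ?case unfolding inv_refl[OF inv] using refl[of A] by (intro ballI)
  next
    case (eng A B)
    show ?case
    proof
      fix C assume "C \<in> M"
      then have "A ** (B ** C) \<in> M" using bspec eng.IH by metis
      then show "(A \<otimes>\<^bsub>GL2\<^esub> B) ** C \<in> M" by (simp only: mult_U2pm matrix_mul_assoc)
    qed
  qed
  have GM: "G \<subseteq> M"
  proof
    fix A assume "A \<in> G"
    moreover have "mat 1 \<in> M" unfolding M_def using evens.one qmat_1 by (metis UnI1 image_eqI)
    ultimately have "A ** mat 1 \<in> M" using gen S(3) by blast
    then show "A \<in> M" by (simp add: matrix_mul_rid)
  qed
  have "refl_pair ?H ?Q"
  proof
    have "inj qmat" using qmat_inject by (auto intro: injI)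
    then have "finite (qmat -` G)" by (rule finite_vimageI[OF fin])
    then show "finite ?H" by (rule finite_subset[rotated]) auto
    show "1 \<in> ?H" using one_closed by (simp add: qmat_1)
    show "g * h \<in> ?H" if "g \<in> ?H" "h \<in> ?H" for g h
      using that m_closed[of "qmat g" "qmat h"] by (simp add: qnorm_mult qmat_mult)
    show "inverse h \<in> ?H" if "h \<in> ?H" for h
      using that m_inv_closed qnorm_inverse inv_qmat(1) by fastforce
    show "q * h \<in> ?Q" if "q \<in> ?Q" "h \<in> ?H" for q h
      using that m_closed[of "iqmat q" "qmat h"] by (simp add: qnorm_mult qmat_mult)
    show "- (p * q) \<in> ?H" if "p \<in> ?Q" "q \<in> ?Q" for p q
      using that m_closed[of "iqmat p" "iqmat q"] by (simp add: qnorm_mult qmat_mult)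
    show "?Q \<inter> imag_units \<noteq> {}" using S(1) SR unfolding R_def by blast
    show "?H \<subseteq> evens (?Q \<inter> imag_units)" unfolding R_def[symmetric]
    proof
      fix h assume h: "h \<in> ?H"
      then have "qmat h \<in> M" using GM by blast
      moreover have "qmat h \<noteq> iqmat q" for q
      proof
        assume e: "qmat h = iqmat q"
        have "qnorm q \<ge> 0" by (simp add: qnorm_def)
        moreover have "qnorm h = - qnorm q"
          using arg_cong[OF e, of det] by (simp add: det_qmat det_iqmat flip: of_real_minus)
        ultimately show False using h by simp
      qed
      ultimately show "h \<in> evens R" unfolding M_def using qmat_inject by auto
    qed
  qed simp_all
  moreover have "G = pmset ?H ?Q"
    using subset by (auto simp: pmset_def carrier_U2pm)
  ultimately show thesis by (rule that)
qed

text \<open>The coset \<open>Q = q H\<close> is built from \<open>orthogonal_generators\<close>.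
  Since \<open>q * s\<close> squares to \<open>- 1\<close>, conjugation by \<open>q\<close> inverts
  each generator \<open>s\<close>, so \<open>q\<close> normalizes \<open>H\<close> and
  \<open>H \<union> \<i> Q\<close> is a group. The product of the reflections \<open>\<i> q\<close>
  and \<open>\<i> q s\<close> is \<open>s\<close>, so reflections generate all of it.\<close>

lemma unit_group_extends:
  assumes "unit_group H"
  obtains Q where "subgroup (pmset H Q) U2pm" "finite_reflection_group (pmset H Q)"
    "\<forall>q\<in>Q. qnorm q = 1"
proof -
  interpret unit_group H by fact
  obtain q S where q: "q \<in> imag_units" and S: "S \<subseteq> H" "H \<subseteq> gen S"
    and qS: "\<And>s. s \<in> S \<Longrightarrow> q * s \<in> imag_units"
    by (rule orthogonal_generators) blast
  note q0 = imag_units_nonzero[OF q] and qi = imag_units_inverse[OF q] and qq = imag_units_sq[OF q]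
  define Q where "Q = (*) q ` H"
  have conj: "q * h * inverse q \<in> H" if "h \<in> H" for h
  proof -
    have "h \<in> gen S" using that S by blast
    then show ?thesis
    proof induction
      case one
      show ?case using q0 unit_group.one[OF assms] by simp
    next
      case (step s g)
      have s: "s \<in> H" "s \<noteq> 0" using step S nonzero by auto
      have "q * s * (q * s) = - 1" using qS[OF step(1)] by (rule imag_units_sq)
      then have "(q * s * inverse q) * s = 1" by (simp add: qi mult.assoc)
      then have "q * s * inverse q = inverse s" using inverse_unique inverse_inverse_eq by metis
      then have "q * s * inverse q \<in> H" using s inv by simp
      then show ?case using step conj_mult[OF q0, of s g] mult by metis
    qed
  qed
  have prod: "- (p * p') \<in> H" if p: "p \<in> Q" "p' \<in> Q" for p p'
  proof -
    obtain h h' where h: "h \<in> H" "h' \<in> H" "p = q * h" "p' = q * h'" using p by (auto simp: Q_def)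
    then have "- (p * p') = (q * h * inverse q) * h'" by (simp add: qi mult.assoc)
    then show ?thesis using h conj mult by simp
  qed
  have left: "h * p \<in> Q" if hp: "h \<in> H" "p \<in> Q" for h p
  proof -
    obtain h' where h': "h' \<in> H" "p = q * h'" using hp by (auto simp: Q_def)
    have "h * p = q * ((q * h * inverse q) * h')"
      using qq by (simp add: h' qi mult.assoc) (simp flip: mult.assoc)
    then show ?thesis using conj hp h' mult unfolding Q_def by blast
  qed
  have right: "p * h \<in> Q" if "h \<in> H" "p \<in> Q" for h p
    using that mult by (auto simp: Q_def mult.assoc)
  have inverseQ: "- inverse p \<in> Q" if p: "p \<in> Q" for p
  proof -
    obtain h where h: "h \<in> H" "p = q * h" using p by (auto simp: Q_def)
    have "- inverse p = inverse h * q"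
      using h q0 nonzero by (simp add: nonzero_inverse_mult_distrib qi)
    moreover have "q \<in> Q" unfolding Q_def using one by force
    ultimately show ?thesis using left inv h by simp
  qed
  have Qn: "qnorm p = 1" if "p \<in> Q" for p
    using that norm imag_units_norm[OF q] by (auto simp: Q_def qnorm_mult)
  let ?G = "pmset H Q"
  have sub: "subgroup ?G U2pm"
  proof (rule subgroup.intro)
    show "?G \<subseteq> carrier U2pm" using norm Qn by (auto simp: pmset_def carrier_U2pm)
    show "A \<otimes>\<^bsub>U2pm\<^esub> B \<in> ?G" if "A \<in> ?G" "B \<in> ?G" for A B
      using that mult prod left right by (auto simp: pmset_def qmat_mult)
    show "\<one>\<^bsub>U2pm\<^esub> \<in> ?G" using one qmat_1 by (auto simp: pmset_def image_iff intro!: bexI[of _ 1])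
    show "inv\<^bsub>U2pm\<^esub> A \<in> ?G" if "A \<in> ?G" for A
      using that inv inverseQ norm Qn by (auto simp: pmset_def inv_qmat)
  qed
  have subGL: "subgroup ?G GL2"
    using group.incl_subgroup[OF group_GL2 subgroup_U2pm_GL2] sub by (simp add: U2pm_def)
  let ?T = "{A \<in> ?G. is_reflection A}"
  have gen: "?G = generate GL2 ?T"
  proof
    show "generate GL2 ?T \<subseteq> ?G"
      by (rule group.generate_subgroup_incl[OF group_GL2 _ subGL]) auto
    have T: "iqmat p \<in> generate GL2 ?T" if "p \<in> Q" "p \<in> imag_units" for p
      using that Qn is_reflection_iqmat by (auto simp: pmset_def intro: generate.incl)
    have qT: "iqmat q \<in> generate GL2 ?T"
      using one q by (intro T) (force simp: Q_def)+
    have H: "qmat h \<in> generate GL2 ?T" if "h \<in> gen S" for h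
      using that
    proof induction
      case one
      show ?case using generate.one[of GL2 ?T] by (simp add: qmat_1)
    next
      case (step s g)
      have "iqmat (q * s) \<in> generate GL2 ?T"
        using step S qS by (intro T) (auto simp: Q_def)
      then have "iqmat q ** iqmat (q * s) \<in> generate GL2 ?T"
        using generate.eng[OF qT] by simp
      moreover have "iqmat q ** iqmat (q * s) = qmat s"
        using qq by (simp add: qmat_mult flip: mult.assoc)
      ultimately have "qmat s ** qmat g \<in> generate GL2 ?T"
        using generate.eng[of "qmat s" GL2 ?T "qmat g"] step by simp
      then show ?case by (simp add: qmat_mult)
    qed
    show "?G \<subseteq> generate GL2 ?T"
    proof
      fix A assume "A \<in> ?G"
      then consider h where "h \<in> H" "A = qmat h" | h where "h \<in> H" "A = iqmat q ** qmat h"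
        by (auto simp: pmset_def Q_def qmat_mult)
      then show "A \<in> generate GL2 ?T"
      proof cases
        case 1
        then show ?thesis using H S by blast
      next
        case 2
        then show ?thesis using generate.eng[OF qT, of "qmat h"] H S by auto
      qed
    qed
  qed
  have "q \<in> Q" using one by (force simp: Q_def)
  then have "iqmat q \<in> ?T"
    using q is_reflection_iqmat[OF imag_units_norm[OF q]] by (simp add: pmset_def)
  then have ne: "?T \<noteq> {}" by blast
  have "finite ?G" using fin by (simp add: pmset_def Q_def)
  moreover have "\<exists>S. S \<noteq> {} \<and> (\<forall>A\<in>S. is_reflection A) \<and> ?G = generate GL2 S"
    by (rule exI[of _ ?T], intro conjI ne gen) simp
  ultimately have "finite_reflection_group ?G"
    unfolding finite_reflection_group_def using subGL by simp
  then show thesis using Qn by (intro that[OF sub]) auto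
qed

text \<open>From left to right, \<open>H\<close> is recovered by intersecting with
  \<open>SU2\<close>. From right to left, once conjugation carries \<open>H\<close> to
  \<open>H'\<close>, the image of \<open>Q\<close> and \<open>Q'\<close> are two cosets for the same
  group, and \<open>refl_pair_unique\<close> supplies a further conjugation that matches them while
  preserving \<open>H'\<close>.\<close>

lemma conj_class_pmset_eq_iff:
  assumes "refl_pair H Q" "refl_pair H' Q'"
  shows "conj_class U2pm (pmset H Q) = conj_class U2pm (pmset H' Q') \<longleftrightarrow>
    conj_class SU2 (qmat ` H) = conj_class SU2 (qmat ` H')"
proof -
  interpret P: refl_pair H Q by fact
  interpret P': refl_pair H' Q' by fact
  show ?thesis
  proof
    assume "conj_class U2pm (pmset H Q) = conj_class U2pm (pmset H' Q')"
    moreover have "pmset H' Q' \<in> conj_class U2pm (pmset H' Q')"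
      unfolding conj_class_U2pm by (intro CollectI exI[of _ 1]) (simp add: cjset_1)
    ultimately obtain k where k: "qnorm k = 1" "pmset H' Q' = pmset (cjset k H) (cjset k Q)"
      unfolding conj_class_U2pm by blast
    have "qmat ` H' = pmset H' Q' \<inter> carrier SU2" using P'.norm P'.Q_norm by (simp add: pmset_SU2)
    also have "\<dots> = qmat ` cjset k H"
      unfolding k(2)
    proof (rule pmset_SU2)
      show "qnorm h = 1" if "h \<in> cjset k H" for h
        by (rule cjset_norm[OF _ k(1) that]) (rule P.norm)
      show "qnorm q = 1" if "q \<in> cjset k Q" for q
        by (rule cjset_norm[OF _ k(1) that]) (rule P.Q_norm)
    qed
    finally have H': "H' = cjset k H" by (simp add: inj_image_eq_iff inj_def qmat_inject)
    \<comment> \<open>Conjugation by \<open>k\<close> only reparametrizes the class.\<close>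
    have "{qmat ` cjset l H' | l. qnorm l = 1} = {qmat ` cjset l H | l. qnorm l = 1}"
    proof (intro subset_antisym subsetI)
      fix D assume "D \<in> {qmat ` cjset l H' | l. qnorm l = 1}"
      then obtain l where l: "qnorm l = 1" "D = qmat ` cjset l H'" by blast
      then have "D = qmat ` cjset (l * k) H" using k H' by (simp add: cjset_cjset)
      moreover have "qnorm (l * k) = 1" using l k by (simp add: qnorm_mult)
      ultimately show "D \<in> {qmat ` cjset l H | l. qnorm l = 1}" by blast
    next
      fix D assume "D \<in> {qmat ` cjset l H | l. qnorm l = 1}"
      then obtain l where l: "qnorm l = 1" "D = qmat ` cjset l H" by blast
      have "H = cjset (inverse k) H'" using cjset_inverse[OF k(1)] H' by simp
      then have "D = qmat ` cjset (l * inverse k) H'"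
        using l(2) cjset_cjset[OF l(1) qnorm_inverse[OF k(1)]] by simp
      moreover have "qnorm (l * inverse k) = 1" using l k qnorm_inverse by (simp add: qnorm_mult)
      ultimately show "D \<in> {qmat ` cjset l H' | l. qnorm l = 1}" by blast
    qed
    then show "conj_class SU2 (qmat ` H) = conj_class SU2 (qmat ` H')"
      by (simp add: conj_class_SU2)
  next
    assume "conj_class SU2 (qmat ` H) = conj_class SU2 (qmat ` H')"
    moreover have "qmat ` H' \<in> conj_class SU2 (qmat ` H')"
      unfolding conj_class_SU2 by (intro CollectI exI[of _ 1]) (simp add: cjset_1)
    ultimately have "qmat ` H' \<in> conj_class SU2 (qmat ` H)" by simp
    then obtain k where "qmat ` H' = qmat ` cjset k H" and k: "qnorm k = 1"
      unfolding conj_class_SU2 mem_Collect_eq by (elim exE conjE)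
    then have H': "H' = cjset k H" by (simp add: inj_image_eq_iff inj_def qmat_inject)
    have "refl_pair H' (cjset k Q)" using refl_pair_cjset[OF k assms(1)] H' by simp
    then obtain g where g: "qnorm g = 1" "cjset g H' = H'" "cjset g (cjset k Q) = Q'"
      using assms(2) unfolding cjset_def by (rule refl_pair_unique)
    define m where "m = g * k"
    have m: "qnorm m = 1" using g k by (simp add: m_def qnorm_mult)
    have e: "H' = cjset m H" "Q' = cjset m Q"
      using g k H' cjset_cjset[OF g(1) k] by (simp_all add: m_def)
    have "{pmset (cjset l H') (cjset l Q') | l. qnorm l = 1} = {pmset (cjset l H) (cjset l Q) | l. qnorm l = 1}"
    proof (intro subset_antisym subsetI)
      fix D assume "D \<in> {pmset (cjset l H') (cjset l Q') | l. qnorm l = 1}"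
      then obtain l where l: "qnorm l = 1" "D = pmset (cjset l H') (cjset l Q')" by blast
      then have "D = pmset (cjset (l * m) H) (cjset (l * m) Q)" using m e by (simp add: cjset_cjset)
      moreover have "qnorm (l * m) = 1" using l m by (simp add: qnorm_mult)
      ultimately show "D \<in> {pmset (cjset l H) (cjset l Q) | l. qnorm l = 1}" by blast
    next
      fix D assume "D \<in> {pmset (cjset l H) (cjset l Q) | l. qnorm l = 1}"
      then obtain l where l: "qnorm l = 1" "D = pmset (cjset l H) (cjset l Q)" by blast
      have "H = cjset (inverse m) H'" "Q = cjset (inverse m) Q'" using cjset_inverse[OF m] e by simp_all
      then have "D = pmset (cjset (l * inverse m) H') (cjset (l * inverse m) Q')"
        using l(2) cjset_cjset[OF l(1) qnorm_inverse[OF m]] by simp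
      moreover have "qnorm (l * inverse m) = 1" using l m qnorm_inverse by (simp add: qnorm_mult)
      ultimately show "D \<in> {pmset (cjset l H') (cjset l Q') | l. qnorm l = 1}" by blast
    qed
    then show "conj_class U2pm (pmset H Q) = conj_class U2pm (pmset H' Q')"
      by (simp add: conj_class_U2pm)
  qed
qed

text \<open>The equivalence \<open>eq\<close> says at once that \<open>f\<close> descends to the
  classes and that the induced map is injective.\<close>

lemma bij_betw_classes:
  assumes eq: "\<And>x y. x \<in> A \<Longrightarrow> y \<in> A \<Longrightarrow> c x = c y \<longleftrightarrow> d (f x) = d (f y)"
    and surj: "(\<lambda>x. d (f x)) ` A = d ` B"
  shows "\<exists>F. bij_betw F (c ` A) (d ` B) \<and> (\<forall>x\<in>A. F (c x) = d (f x))"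
proof -
  define F where "F z = d (f (inv_into A c z))" for z
  have F: "F (c x) = d (f x)" if "x \<in> A" for x
    unfolding F_def using eq[of "inv_into A c (c x)" x] that
    by (simp add: f_inv_into_f inv_into_into)
  have "inj_on F (c ` A)" using F eq by (auto intro!: inj_onI)
  moreover have "F ` c ` A = d ` B" using F surj by (auto simp: image_image)
  ultimately show ?thesis using F by (auto simp: bij_betw_def)
qed

theorem proposition3p15:
  defines "RG \<equiv> {G. subgroup G U2pm \<and> finite_reflection_group G}"
    and "FS \<equiv> {H. subgroup H SU2 \<and> finite H}"
  shows "\<exists>\<Phi>. bij_betw \<Phi> (conj_class U2pm ` RG) (conj_class SU2 ` FS) \<and>
           (\<forall>G\<in>RG. \<Phi> (conj_class U2pm G) = conj_class SU2 (G \<inter> carrier SU2))"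
proof (rule bij_betw_classes)
  have RG: "\<exists>H Q. refl_pair H Q \<and> G = pmset H Q \<and> G \<inter> carrier SU2 = qmat ` H" if G: "G \<in> RG" for G
  proof -
    obtain H Q where HQ: "refl_pair H Q" "G = pmset H Q"
      using G reflection_group_refl_pair unfolding RG_def by blast
    interpret refl_pair H Q by fact
    show ?thesis using HQ pmset_SU2[of H Q] norm Q_norm by blast
  qed
  show "conj_class U2pm G = conj_class U2pm G' \<longleftrightarrow>
      conj_class SU2 (G \<inter> carrier SU2) = conj_class SU2 (G' \<inter> carrier SU2)"
    if G: "G \<in> RG" "G' \<in> RG" for G G'
  proof -
    obtain H Q where HQ: "refl_pair H Q" "G = pmset H Q" "G \<inter> carrier SU2 = qmat ` H"
      using RG[OF G(1)] by blast
    obtain H' Q' where HQ': "refl_pair H' Q'" "G' = pmset H' Q'" "G' \<inter> carrier SU2 = qmat ` H'"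
      using RG[OF G(2)] by blast
    show ?thesis
      unfolding HQ(3) HQ'(3) unfolding HQ(2) HQ'(2) by (rule conj_class_pmset_eq_iff[OF HQ(1) HQ'(1)])
  qed
  show "(\<lambda>G. conj_class SU2 (G \<inter> carrier SU2)) ` RG = conj_class SU2 ` FS"
  proof (intro subset_antisym subsetI)
    fix D assume "D \<in> (\<lambda>G. conj_class SU2 (G \<inter> carrier SU2)) ` RG"
    then obtain G where G: "G \<in> RG" "D = conj_class SU2 (G \<inter> carrier SU2)"
      by (elim imageE)
    have "subgroup (G \<inter> carrier SU2) SU2"
    proof -
      have "subgroup (G \<inter> carrier SU2) U2pm"
        using G subgroup_SU2_U2pm group.subgroups_Inter_pair[OF group_U2pm] by (simp add: RG_def)
      then have "subgroup (G \<inter> carrier SU2) (U2pm\<lparr>carrier := carrier SU2\<rparr>)"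
        using group.subgroup_incl[OF group_U2pm _ subgroup_SU2_U2pm] by blast
      then show ?thesis by (simp add: SU2_def)
    qed
    moreover have "finite (G \<inter> carrier SU2)"
      using G by (simp add: RG_def finite_reflection_group_def)
    ultimately have "G \<inter> carrier SU2 \<in> FS" by (simp add: FS_def)
    with G(2) show "D \<in> conj_class SU2 ` FS" by (rule image_eqI)
  next
    fix D assume "D \<in> conj_class SU2 ` FS"
    then obtain K where K: "subgroup K SU2" "finite K" "D = conj_class SU2 K"
      unfolding FS_def by (elim imageE CollectE conjE)
    obtain H where H: "unit_group H" "K = qmat ` H" using K(1,2) by (rule subgroup_SU2_unit_group)
    obtain Q where Q: "subgroup (pmset H Q) U2pm" "finite_reflection_group (pmset H Q)"
      "\<forall>q\<in>Q. qnorm q = 1" using H(1) by (rule unit_group_extends)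
    have "pmset H Q \<inter> carrier SU2 = K"
      unfolding H(2) using Q(3) unit_group.norm[OF H(1)] by (intro pmset_SU2) blast+
    then have "D = conj_class SU2 (pmset H Q \<inter> carrier SU2)" using K(3) by simp
    moreover have "pmset H Q \<in> RG" using Q(1,2) by (simp add: RG_def)
    ultimately show "D \<in> (\<lambda>G. conj_class SU2 (G \<inter> carrier SU2)) ` RG" by (rule image_eqI)
  qed
qed

end
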